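(* Let $k$ be a field of characteristic $p\ge 0$ and let $H$ be a finite dimensional involutory quasi-Hopf algebra over $k$. If $H$ is not semisimple, then $p$ divides the dimension $\dim_k P$ of any finite dimensional projective left $H$-module $P$.
   Context: All algebras and linear spaces are over the field $k$; $\otimes=\otimes_k$. A quasi-bialgebra is a tuple $(H,\Delta,\varepsilon,\Phi)$ where $H$ is an associative unital algebra, $\Phi\in H\otimes H\otimes H$ is invertible, and $\Delta:H\to H\otimes H$, $\varepsilon:H\to k$ are algebra homomorphisms such that, for all $h\in H$: $(\mathrm{id}\otimes\Delta)(\Delta(h))=\Phi(\Delta\otimes \mathrm{id})(\Delta(h))\Phi^{-1}$; $(\mathrm{id}\otimes\varepsilon)(\Delta(h))=h=(\varepsilon\otimes \mathrm{id})(\Delta(h))$; $(1\otimes\Phi)(\mathrm{id}\otimes\Delta\otimes \mathrm{id})(\Phi)(\Phi\otimes 1)=(\mathrm{id}\otimes \mathrm{id}\otimes\Delta)(\Phi)(\Delta\otimes \mathrm{id}\otimes \mathrm{id})(\Phi)$; $(\mathrm{id}\otimes\varepsilon\otimes \mathrm{id})(\Phi)=1\otimes 1$. Write $\Delta(h)=h_1\otimes h_2$, $\Phi=X^1\otimes X^2\otimes X^3$, $\Phi^{-1}=x^1\otimes x^2\otimes x^3$ (summation understood; superscripts label tensor components). $H$ is a quasi-Hopf algebra if moreover there are an algebra anti-morphism $S:H\to H$ (the antipode, not required to be bijective) and elements $\alpha,\beta\in H$ with $S(h_1)\alpha h_2=\varepsilon(h)\alpha$, $h_1\beta S(h_2)=\varepsilon(h)\beta$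 for all $h\in H$, and $X^1\beta S(X^2)\alpha X^3=1$, $S(x^1)\alpha x^2\beta S(x^3)=1$. One normalizes (without loss of generality) $\varepsilon(\alpha)=\varepsilon(\beta)=1$. $H$ is called involutory if $S^2(h)=S(\beta)\alpha h\beta S(\alpha)$ for all $h\in H$. Semisimple means semisimple as an algebra. *)

theory Defs
  imports "HOL-Computational_Algebra.Computational_Algebra" "HOL-Library.Poly_Mapping"
begin

section \<open>Formal linear combinations\<close>

definition fscale :: "'k::field \<Rightarrow> ('a \<Rightarrow>\<^sub>0 'k) \<Rightarrow> ('a \<Rightarrow>\<^sub>0 'k)" where
  "fscale c t = Poly_Mapping.map ((*) c) t"

definition lin_ext :: "('k::zero \<Rightarrow> 'v \<Rightarrow> 'v) \<Rightarrow> ('a \<Rightarrow> 'v) \<Rightarrow> ('a \<Rightarrow>\<^sub>0 'k) \<Rightarrow> 'v::comm_monoid_add" where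
  "lin_ext sc f t = (\<Sum>w\<in>Poly_Mapping.keys t. sc (Poly_Mapping.lookup t w) (f w))"

abbreviation word :: "'a \<Rightarrow> ('a \<Rightarrow>\<^sub>0 'k::field)" where
  "word w \<equiv> Poly_Mapping.single w 1"

definition finite_dim :: "('k::field \<Rightarrow> 'v \<Rightarrow> 'v::ab_group_add) \<Rightarrow> bool" where
  "finite_dim sc \<longleftrightarrow> (\<exists>B. finite B \<and> module.span sc B = UNIV)"


lemma lookup_fscale [simp]: "Poly_Mapping.lookup (fscale c t) w = c * Poly_Mapping.lookup t w"
  by (simp add: fscale_def Poly_Mapping.map.rep_eq when_def)

lemma vector_space_fscale: "vector_space fscale"
  by unfold_locales (auto intro!: poly_mapping_eqI simp: lookup_add algebra_simps)

lemma lin_ext_superset: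
  assumes "vector_space sc" "finite A" "Poly_Mapping.keys t \<subseteq> A"
  shows "lin_ext sc f t = (\<Sum>w\<in>A. sc (Poly_Mapping.lookup t w) (f w))"
proof -
  interpret vector_space sc by fact
  show ?thesis unfolding lin_ext_def
    by (rule sum.mono_neutral_left) (use assms in \<open>auto simp: in_keys_iff\<close>)
qed

lemma lin_ext_add:
  assumes "vector_space sc"
  shows "lin_ext sc f (s + t) = lin_ext sc f s + lin_ext sc f t"
proof -
  interpret vector_space sc by fact
  let ?A = "Poly_Mapping.keys s \<union> Poly_Mapping.keys t"
  have "Poly_Mapping.keys (s + t) \<subseteq> ?A" by (rule Poly_Mapping.keys_add)
  then show ?thesis
    using lin_ext_superset[OF assms, of ?A "s + t" f] lin_ext_superset[OF assms, of ?A s f]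
      lin_ext_superset[OF assms, of ?A t f]
    by (simp add: lookup_add scale_left_distrib sum.distrib)
qed

lemma lin_ext_scale:
  assumes "vector_space sc"
  shows "lin_ext sc f (fscale c t) = sc c (lin_ext sc f t)"
proof -
  interpret vector_space sc by fact
  have "Poly_Mapping.keys (fscale c t) \<subseteq> Poly_Mapping.keys t" by (auto simp: in_keys_iff)
  then show ?thesis
    using lin_ext_superset[OF assms, of "Poly_Mapping.keys t" "fscale c t" f]
    by (simp add: lin_ext_def scale_sum_right)
qed

lemma lin_ext_word [simp]: "vector_space sc \<Longrightarrow> lin_ext sc f (word w) = f w"
  by (simp add: lin_ext_def vector_space_def)

lemma lin_ext_diff:
  assumes "vector_space sc"
  shows "lin_ext sc f (s - t) = lin_ext sc f s - lin_ext sc f t"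
  using lin_ext_add[OF assms, of f "s - t" t] by (simp add: algebra_simps)


section \<open>Algebras over a field\<close>

locale assoc_algebra = vector_space scale
  for scale :: "'k::field \<Rightarrow> 'h::ring_1 \<Rightarrow> 'h" +
  assumes scale_mult_left: "scale c x * y = scale c (x * y)"
    and scale_mult_right: "x * scale c y = scale c (x * y)"


section \<open>Tensor powers\<close>

text \<open>
  The $n$-th tensor power of a vector space over \<open>'k\<close> with underlying type \<open>'h\<close> is the vector space
  with basis the words of length \<open>n\<close> (the word \<open>[h\<^sub>1, \<dots>, h\<^sub>n]\<close> standing for
  $h_1 \otimes \cdots \otimes h_n$), modulo the subspace generated by the multilinearity relations.
  Its elements are cosets of that subspace.  A quotient type is not available, because the
  relations depend on the scalar multiplication, which is a term.
\<close>

type_synonym ('h, 'k) tensor = "('h list \<Rightarrow>\<^sub>0 'k) set"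

definition formal_tensors :: "nat \<Rightarrow> ('h list \<Rightarrow>\<^sub>0 'k::field) set" where
  "formal_tensors n = {t. \<forall>w\<in>Poly_Mapping.keys t. length w = n}"

context assoc_algebra
begin

definition tensor_relators :: "nat \<Rightarrow> ('h list \<Rightarrow>\<^sub>0 'k) set" where
  "tensor_relators n =
     {word (u @ (x + y) # v) - word (u @ x # v) - word (u @ y # v) | u v x y.
        length u + 1 + length v = n} \<union>
     {word (u @ scale c x # v) - fscale c (word (u @ x # v)) | u v c x.
        length u + 1 + length v = n}"

definition tensor_class :: "nat \<Rightarrow> ('h list \<Rightarrow>\<^sub>0 'k) \<Rightarrow> ('h, 'k) tensor" where
  "tensor_class n t = {s. s - t \<in> module.span fscale (tensor_relators n)}"

definition tensor_power :: "nat \<Rightarrow> ('h, 'k) tensor set" where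
  "tensor_power n = tensor_class n ` formal_tensors n"

definition pure_tensor :: "'h list \<Rightarrow> ('h, 'k) tensor" where
  "pure_tensor w = tensor_class (length w) (word w)"

end

text \<open>
  The linear map \<open>tensor_lift sc f\<close> from a tensor power to a vector space with scalar
  multiplication \<open>sc\<close> that is induced by the multilinear map \<open>f\<close>, i.e. the Sweedler-style sum
  $\sum f(t_1, \ldots, t_n)$ for $t = \sum t_1 \otimes \cdots \otimes t_n$.  It is computed on an
  arbitrary representative; \<open>tensor_lift_class\<close> below shows that the choice is irrelevant.
\<close>

definition tensor_lift ::
    "('k::field \<Rightarrow> 'v \<Rightarrow> 'v) \<Rightarrow> ('h list \<Rightarrow> 'v) \<Rightarrow> ('h, 'k) tensor \<Rightarrow> 'v::comm_monoid_add" where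
  "tensor_lift sc f T = lin_ext sc f (SOME t. t \<in> T)"

context assoc_algebra
begin

definition multilinear :: "nat \<Rightarrow> ('k \<Rightarrow> 'v \<Rightarrow> 'v::ab_group_add) \<Rightarrow> ('h list \<Rightarrow> 'v) \<Rightarrow> bool" where
  "multilinear n sc f \<longleftrightarrow>
     (\<forall>u v x y. length u + 1 + length v = n \<longrightarrow>
        f (u @ (x + y) # v) = f (u @ x # v) + f (u @ y # v)) \<and>
     (\<forall>u v c x. length u + 1 + length v = n \<longrightarrow>
        f (u @ scale c x # v) = sc c (f (u @ x # v)))"

definition tensor_add :: "nat \<Rightarrow> ('h, 'k) tensor \<Rightarrow> ('h, 'k) tensor \<Rightarrow> ('h, 'k) tensor" where
  "tensor_add n S T = tensor_class n (tensor_lift fscale word S + tensor_lift fscale word T)"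

definition tensor_scale :: "nat \<Rightarrow> 'k \<Rightarrow> ('h, 'k) tensor \<Rightarrow> ('h, 'k) tensor" where
  "tensor_scale n c T = tensor_class n (fscale c (tensor_lift fscale word T))"

definition tensor_append :: "nat \<Rightarrow> nat \<Rightarrow> ('h, 'k) tensor \<Rightarrow> ('h, 'k) tensor \<Rightarrow> ('h, 'k) tensor" where
  "tensor_append m n S T =
     tensor_class (m + n)
       (tensor_lift fscale (\<lambda>u. tensor_lift fscale (\<lambda>v. word (u @ v)) T) S)"

text \<open>
  \<open>id \<otimes> \<dots> \<otimes> D \<otimes> \<dots> \<otimes> id\<close> on the \<open>n\<close>-th tensor power, for a linear map \<open>D\<close> into
  the second tensor power, respectively a linear form \<open>e\<close>, acting on the tensor factor with
  index \<open>i < n\<close>, counted from 0.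
\<close>

definition apply_comult ::
    "('h \<Rightarrow> ('h, 'k) tensor) \<Rightarrow> nat \<Rightarrow> nat \<Rightarrow> ('h, 'k) tensor \<Rightarrow> ('h, 'k) tensor" where
  "apply_comult D n i T =
     tensor_class (n + 1)
       (tensor_lift fscale
          (\<lambda>w. tensor_lift fscale (\<lambda>v. word (take i w @ v @ drop (Suc i) w)) (D (w ! i))) T)"

definition apply_counit ::
    "('h \<Rightarrow> 'k) \<Rightarrow> nat \<Rightarrow> nat \<Rightarrow> ('h, 'k) tensor \<Rightarrow> ('h, 'k) tensor" where
  "apply_counit e n i T =
     tensor_class (n - 1)
       (tensor_lift fscale (\<lambda>w. fscale (e (w ! i)) (word (take i w @ drop (Suc i) w))) T)"

definition tensor_mult :: "nat \<Rightarrow> ('h, 'k) tensor \<Rightarrow> ('h, 'k) tensor \<Rightarrow> ('h, 'k) tensor" where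
  "tensor_mult n S T =
     tensor_class n
       (tensor_lift fscale (\<lambda>u. tensor_lift fscale (\<lambda>v. word (map2 (*) u v)) T) S)"

definition tensor_one :: "nat \<Rightarrow> ('h, 'k) tensor" where
  "tensor_one n = pure_tensor (replicate n 1)"

end

context assoc_algebra
begin

lemma lin_ext_relator:
  assumes "vector_space sc" "multilinear n sc f" "r \<in> module.span fscale (tensor_relators n)"
  shows "lin_ext sc f r = 0"
proof -
  interpret fs: vector_space fscale by (rule vector_space_fscale)
  interpret sc: vector_space sc by fact
  from assms(3) show ?thesis
  proof (induction rule: fs.span_induct_alt)
    case base
    show ?case by (simp add: lin_ext_def)
  next
    case (step c r s)
    then have "lin_ext sc f r = 0"
      using assms(2) unfolding tensor_relators_def multilinear_def
      by (auto simp: lin_ext_diff[OF assms(1)] lin_ext_scale[OF assms(1)] assms(1))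
    with step show ?case by (simp add: lin_ext_add[OF assms(1)] lin_ext_scale[OF assms(1)])
  qed
qed

lemma tensor_class_rep: "(SOME s. s \<in> tensor_class n t) \<in> tensor_class n t"
proof -
  interpret fs: vector_space fscale by (rule vector_space_fscale)
  have "t \<in> tensor_class n t" by (simp add: tensor_class_def fs.span_zero)
  then show ?thesis by (rule someI)
qed

lemma tensor_lift_class:
  assumes "vector_space sc" "multilinear n sc f"
  shows "tensor_lift sc f (tensor_class n t) = lin_ext sc f t"
proof -
  let ?s = "SOME s. s \<in> tensor_class n t"
  have "?s - t \<in> module.span fscale (tensor_relators n)"
    using tensor_class_rep[of n t] by (simp add: tensor_class_def)
  from lin_ext_relator[OF assms this] show ?thesis
    by (simp add: tensor_lift_def lin_ext_diff[OF assms(1)])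
qed

end


section \<open>Quasi-Hopf algebras\<close>

text \<open>
  Here \<open>\<Phi>i\<close> is the inverse of \<open>\<Phi>\<close>, which is determined by \<open>\<Phi>\<close>.  In \<open>counit_right\<close> and
  \<open>counit_left\<close>, $H \otimes k$ and $k \otimes H$ are identified with $H$.
\<close>

locale quasi_bialgebra = assoc_algebra scale
  for scale :: "'k::field \<Rightarrow> 'h::ring_1 \<Rightarrow> 'h" +
  fixes \<Delta> :: "'h \<Rightarrow> ('h, 'k) tensor"
    and \<epsilon> :: "'h \<Rightarrow> 'k"
    and \<Phi> \<Phi>i :: "('h, 'k) tensor"
  assumes comult_closed: "\<Delta> x \<in> tensor_power 2"
    and comult_add: "\<Delta> (x + y) = tensor_add 2 (\<Delta> x) (\<Delta> y)"
    and comult_scale: "\<Delta> (scale c x) = tensor_scale 2 c (\<Delta> x)"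
    and comult_mult: "\<Delta> (x * y) = tensor_mult 2 (\<Delta> x) (\<Delta> y)"
    and comult_one: "\<Delta> 1 = tensor_one 2"
    and counit_add: "\<epsilon> (x + y) = \<epsilon> x + \<epsilon> y"
    and counit_scale: "\<epsilon> (scale c x) = c * \<epsilon> x"
    and counit_mult: "\<epsilon> (x * y) = \<epsilon> x * \<epsilon> y"
    and counit_one: "\<epsilon> 1 = 1"
    and assoc_closed: "\<Phi> \<in> tensor_power 3"
    and assoc_inv_closed: "\<Phi>i \<in> tensor_power 3"
    and assoc_right_inv: "tensor_mult 3 \<Phi> \<Phi>i = tensor_one 3"
    and assoc_left_inv: "tensor_mult 3 \<Phi>i \<Phi> = tensor_one 3"
    and quasi_coassoc:
      "apply_comult \<Delta> 2 1 (\<Delta> h) =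
         tensor_mult 3 (tensor_mult 3 \<Phi> (apply_comult \<Delta> 2 0 (\<Delta> h))) \<Phi>i"
    and counit_right: "tensor_lift scale (\<lambda>w. scale (\<epsilon> (w ! 1)) (w ! 0)) (\<Delta> h) = h"
    and counit_left: "tensor_lift scale (\<lambda>w. scale (\<epsilon> (w ! 0)) (w ! 1)) (\<Delta> h) = h"
    and pentagon:
      "tensor_mult 4
         (tensor_mult 4 (tensor_append 1 3 (tensor_one 1) \<Phi>) (apply_comult \<Delta> 3 1 \<Phi>))
         (tensor_append 3 1 \<Phi> (tensor_one 1)) =
       tensor_mult 4 (apply_comult \<Delta> 3 2 \<Phi>) (apply_comult \<Delta> 3 0 \<Phi>)"
    and assoc_counit: "apply_counit \<epsilon> 3 1 \<Phi> = tensor_one 2"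

locale quasi_hopf_algebra = quasi_bialgebra scale \<Delta> \<epsilon> \<Phi> \<Phi>i
  for scale :: "'k::field \<Rightarrow> 'h::ring_1 \<Rightarrow> 'h"
    and \<Delta> :: "'h \<Rightarrow> ('h, 'k) tensor"
    and \<epsilon> :: "'h \<Rightarrow> 'k"
    and \<Phi> \<Phi>i :: "('h, 'k) tensor" +
  fixes S :: "'h \<Rightarrow> 'h" and \<alpha> \<beta> :: 'h
  assumes antipode_add: "S (x + y) = S x + S y"
    and antipode_scale: "S (scale c x) = scale c (S x)"
    and antipode_mult: "S (x * y) = S y * S x"
    and antipode_one: "S 1 = 1"
    and antipode_left:
      "tensor_lift scale (\<lambda>w. S (w ! 0) * \<alpha> * w ! 1) (\<Delta> h) = scale (\<epsilon> h) \<alpha>"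
    and antipode_right:
      "tensor_lift scale (\<lambda>w. w ! 0 * \<beta> * S (w ! 1)) (\<Delta> h) = scale (\<epsilon> h) \<beta>"
    and antipode_assoc:
      "tensor_lift scale (\<lambda>w. w ! 0 * \<beta> * S (w ! 1) * \<alpha> * w ! 2) \<Phi> = 1"
    and antipode_assoc_inv:
      "tensor_lift scale (\<lambda>w. S (w ! 0) * \<alpha> * w ! 1 * \<beta> * S (w ! 2)) \<Phi>i = 1"
    and counit_alpha: "\<epsilon> \<alpha> = 1"
    and counit_beta: "\<epsilon> \<beta> = 1"

definition involutory :: "('h::ring_1 \<Rightarrow> 'h) \<Rightarrow> 'h \<Rightarrow> 'h \<Rightarrow> bool" where
  "involutory S \<alpha> \<beta> \<longleftrightarrow> (\<forall>h. S (S h) = S \<beta> * \<alpha> * h * \<beta> * S \<alpha>)"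


section \<open>Modules over a not necessarily commutative ring\<close>

locale left_module =
  fixes act :: "'h::ring_1 \<Rightarrow> 'm::ab_group_add \<Rightarrow> 'm"
  assumes act_add_left: "act (a + b) x = act a x + act b x"
    and act_add_right: "act a (x + y) = act a x + act a y"
    and act_mult: "act (a * b) x = act a (act b x)"
    and act_one: "act 1 x = x"

definition module_map ::
    "('h \<Rightarrow> 'm \<Rightarrow> 'm) \<Rightarrow> ('h \<Rightarrow> 'n \<Rightarrow> 'n) \<Rightarrow> ('m::ab_group_add \<Rightarrow> 'n::ab_group_add) \<Rightarrow> bool" where
  "module_map act act' f \<longleftrightarrow>
     (\<forall>x y. f (x + y) = f x + f y) \<and> (\<forall>h x. f (act h x) = act' h (f x))"

definition submodule :: "('h \<Rightarrow> 'm \<Rightarrow> 'm) \<Rightarrow> 'm::ab_group_add set \<Rightarrow> bool" where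
  "submodule act U \<longleftrightarrow>
     0 \<in> U \<and> (\<forall>x\<in>U. \<forall>y\<in>U. x + y \<in> U) \<and> (\<forall>h. \<forall>x\<in>U. act h x \<in> U)"

definition semisimple_module :: "('h \<Rightarrow> 'm \<Rightarrow> 'm::ab_group_add) \<Rightarrow> bool" where
  "semisimple_module act \<longleftrightarrow>
     (\<forall>U. submodule act U \<longrightarrow>
        (\<exists>W. submodule act W \<and> U \<inter> W = {0} \<and> {u + w | u w. u \<in> U \<and> w \<in> W} = UNIV))"

definition semisimple_ring :: "'h::ring_1 itself \<Rightarrow> bool" where
  "semisimple_ring _ \<longleftrightarrow> semisimple_module ((*) :: 'h \<Rightarrow> 'h \<Rightarrow> 'h)"

text \<open>The free left module with basis indexed by the type \<open>'i\<close> is \<open>'i \<Rightarrow>\<^sub>0 'h\<close>.\<close>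

definition free_act :: "'h::ring_1 \<Rightarrow> ('i \<Rightarrow>\<^sub>0 'h) \<Rightarrow> ('i \<Rightarrow>\<^sub>0 'h)" where
  "free_act h t = Poly_Mapping.map ((*) h) t"

text \<open>
  A module is projective if it is a direct summand of a free module.  It is enough to allow the
  free module on the elements of the module, see \<open>projective_if_summand\<close>; equivalence with the
  lifting property, which cannot be quantified over all types in a definition, is
  \<open>projective_lifting\<close> together with \<open>projective_if_lifting\<close>.
\<close>

definition projective :: "('h::ring_1 \<Rightarrow> 'm \<Rightarrow> 'm::ab_group_add) \<Rightarrow> bool" where
  "projective act \<longleftrightarrow>
     (\<exists>(i :: 'm \<Rightarrow> ('m \<Rightarrow>\<^sub>0 'h)) q.
        module_map act free_act i \<and> module_map free_act act q \<and> (\<forall>x. q (i x) = x))"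

lemma lookup_free_act [simp]: "Poly_Mapping.lookup (free_act h t) w = h * Poly_Mapping.lookup t w"
  by (simp add: free_act_def Poly_Mapping.map.rep_eq when_def)

lemma left_module_free_act: "left_module free_act"
  by unfold_locales (auto intro!: poly_mapping_eqI simp: lookup_add algebra_simps)

text \<open>The module map out of a free module with prescribed values on the basis.\<close>

definition free_lift :: "('h::ring_1 \<Rightarrow> 'm \<Rightarrow> 'm::ab_group_add) \<Rightarrow> ('i \<Rightarrow> 'm) \<Rightarrow> ('i \<Rightarrow>\<^sub>0 'h) \<Rightarrow> 'm" where
  "free_lift act f t = (\<Sum>w\<in>Poly_Mapping.keys t. act (Poly_Mapping.lookup t w) (f w))"

context left_module
begin

lemma act_zero_left [simp]: "act 0 x = 0"
  using act_add_left[of 0 0 x] by simp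

lemma act_zero_right [simp]: "act a 0 = 0"
  using act_add_right[of a 0 0] by simp

lemma act_sum: "act a (sum f A) = (\<Sum>x\<in>A. act a (f x))"
  by (induction A rule: infinite_finite_induct) (auto simp: act_add_right)

lemma free_lift_superset:
  assumes "finite A" "Poly_Mapping.keys t \<subseteq> A"
  shows "free_lift act f t = (\<Sum>w\<in>A. act (Poly_Mapping.lookup t w) (f w))"
  unfolding free_lift_def
  by (rule sum.mono_neutral_left) (use assms in \<open>auto simp: in_keys_iff\<close>)

lemma free_lift_single [simp]: "free_lift act f (Poly_Mapping.single x h) = act h (f x)"
  by (simp add: free_lift_def)

lemma module_map_free_lift:
  fixes f :: "'c \<Rightarrow> 'm"
  shows "module_map free_act act (free_lift act f)"
  unfolding module_map_def
proof (intro conjI allI)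
  fix s t :: "'c \<Rightarrow>\<^sub>0 'h"
  let ?A = "Poly_Mapping.keys s \<union> Poly_Mapping.keys t"
  have "Poly_Mapping.keys (s + t) \<subseteq> ?A" by (rule Poly_Mapping.keys_add)
  then show "free_lift act f (s + t) = free_lift act f s + free_lift act f t"
    using free_lift_superset[of ?A "s + t" f] free_lift_superset[of ?A s f]
      free_lift_superset[of ?A t f]
    by (simp add: lookup_add act_add_left sum.distrib)
next
  fix h and t :: "'c \<Rightarrow>\<^sub>0 'h"
  have "Poly_Mapping.keys (free_act h t) \<subseteq> Poly_Mapping.keys t" by (auto simp: in_keys_iff)
  then show "free_lift act f (free_act h t) = act h (free_lift act f t)"
    using free_lift_superset[of "Poly_Mapping.keys t" "free_act h t" f]
    by (simp add: free_lift_def act_sum act_mult)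
qed

end

lemma module_map_comp:
  "module_map a b f \<Longrightarrow> module_map b c g \<Longrightarrow> module_map a c (\<lambda>x. g (f x))"
  by (simp add: module_map_def)

lemma free_map_eqI:
  fixes f g :: "('i \<Rightarrow>\<^sub>0 'h::ring_1) \<Rightarrow> 'm::ab_group_add"
  assumes f: "module_map free_act act f" and g: "module_map free_act act g"
    and eq: "\<And>x. f (Poly_Mapping.single x 1) = g (Poly_Mapping.single x 1)"
  shows "f t = g t"
proof (induction t rule: update_induct)
  case const
  have "f (0 + 0) = f 0 + f 0" "g (0 + 0) = g 0 + g 0"
    using f g unfolding module_map_def by blast+
  then show ?case by simp
next
  case (update t x h)
  then have "Poly_Mapping.update x h t = t + free_act h (Poly_Mapping.single x 1)"
    by (intro poly_mapping_eqI) (auto simp: lookup_update lookup_add lookup_single in_keys_iff)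
  then show ?case using update f g eq by (simp add: module_map_def)
qed

lemma projective_lifting:
  fixes act :: "'h::ring_1 \<Rightarrow> 'm::ab_group_add \<Rightarrow> 'm"
    and actA :: "'h \<Rightarrow> 'a::ab_group_add \<Rightarrow> 'a" and actB :: "'h \<Rightarrow> 'b::ab_group_add \<Rightarrow> 'b"
  assumes "projective act" "left_module actA"
    and g: "module_map actA actB g" "surj g" and f: "module_map act actB f"
  shows "\<exists>f'. module_map act actA f' \<and> (\<forall>x. g (f' x) = f x)"
proof -
  from assms(1) obtain i :: "'m \<Rightarrow> ('m \<Rightarrow>\<^sub>0 'h)" and q where
    i: "module_map act free_act i" and q: "module_map free_act act q" and qi: "\<And>x. q (i x) = x"
    unfolding projective_def by blast
  interpret A: left_module actA by fact
  define l where "l = free_lift actA (\<lambda>x. inv g (f (q (Poly_Mapping.single x 1))))"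
  have l: "module_map free_act actA l" unfolding l_def by (rule A.module_map_free_lift)
  have "g (l t) = f (q t)" for t
    by (rule free_map_eqI[OF module_map_comp[OF l g(1)] module_map_comp[OF q f]])
      (simp add: l_def A.act_one surj_f_inv_f[OF g(2)])
  then show ?thesis using module_map_comp[OF i l] qi by (intro exI[of _ "\<lambda>x. l (i x)"]) simp
qed

lemma projective_if_lifting:
  fixes act :: "'h::ring_1 \<Rightarrow> 'm::ab_group_add \<Rightarrow> 'm"
  assumes "left_module act"
    and lifting: "\<And>g :: ('m \<Rightarrow>\<^sub>0 'h) \<Rightarrow> 'm. module_map free_act act g \<Longrightarrow> surj g \<Longrightarrow>
      \<exists>f'. module_map act free_act f' \<and> (\<forall>x. g (f' x) = x)"
  shows "projective act"
proof -
  interpret left_module act by fact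
  let ?g = "free_lift act (\<lambda>x. x)"
  have "surj ?g" by (rule surjI[of _ "\<lambda>x. Poly_Mapping.single x 1"]) (simp add: act_one)
  from lifting[OF module_map_free_lift this] show ?thesis
    unfolding projective_def using module_map_free_lift by blast
qed

lemma projective_if_summand:
  fixes act :: "'h::ring_1 \<Rightarrow> 'm::ab_group_add \<Rightarrow> 'm" and i :: "'m \<Rightarrow> ('i \<Rightarrow>\<^sub>0 'h)"
  assumes "left_module act"
    and i: "module_map act free_act i" and q: "module_map free_act act q" and qi: "\<And>x. q (i x) = x"
  shows "projective act"
proof (rule projective_if_lifting[OF assms(1)])
  fix g :: "('m \<Rightarrow>\<^sub>0 'h) \<Rightarrow> 'm"
  assume g: "module_map free_act act g" "surj g"
  interpret A: left_module "free_act :: 'h \<Rightarrow> ('m \<Rightarrow>\<^sub>0 'h) \<Rightarrow> _" by (rule left_module_free_act)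
  define l where "l = free_lift free_act (\<lambda>x. inv g (q (Poly_Mapping.single x 1)))"
  have l: "module_map free_act free_act l" unfolding l_def by (rule A.module_map_free_lift)
  have "g (l t) = q t" for t
    by (rule free_map_eqI[OF module_map_comp[OF l g(1)] q])
      (simp add: l_def A.act_one surj_f_inv_f[OF g(2)])
  then show "\<exists>f'. module_map act free_act f' \<and> (\<forall>x. g (f' x) = x)"
    using module_map_comp[OF i l] qi by (intro exI[of _ "\<lambda>x. l (i x)"]) simp
qed

end

theory Submission
  imports Defs
begin

text \<open>
  Let $P$ be a finite dimensional projective module.  The module map
  $\varepsilon \otimes id : H \otimes P \to P$ is surjective, so it has an $H$-linear section $\sigma$.
  Put $u = S(\beta)\alpha$; since $H$ is involutory, $u$ is invertible with inverse $\beta S(\alpha)$ and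
  $S^2(h) = u h u^{-1}$.  Applying $S$ to the axiom $S(h_1) \alpha h_2 = \varepsilon(h) \alpha$ gives
  $S(h_2) \kappa h_1 = \varepsilon(h) \kappa$ for $\kappa = S(\alpha) u$.  The partial trace over $P$ of
  $x \mapsto (X^1 \otimes S(X^3) \kappa X^2) \sigma(\beta x)$ is therefore a left integral $t \in H$, and
  $\varepsilon(t)$ is the trace of $\kappa \beta$ on $P$, which by cyclicity is the trace of
  $u \beta S(\alpha) = 1$, that is, $\dim P$.  If this is not zero in $k$, then averaging a linear
  projection onto a left ideal by $t$, as in Maschke's theorem, makes $H$ semisimple.
\<close>

section \<open>Sums over tensors\<close>

lemma lin_ext_sum:
  assumes "vector_space sc"
  shows "lin_ext sc f (\<Sum>i\<in>I. g i) = (\<Sum>i\<in>I. lin_ext sc f (g i))"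
  by (induction I rule: infinite_finite_induct)
    (auto simp: lin_ext_add[OF assms], auto simp: lin_ext_def)

lemma lin_ext_lin_ext:
  assumes "vector_space sc"
  shows "lin_ext sc f (lin_ext fscale g t) = lin_ext sc (\<lambda>w. lin_ext sc f (g w)) t"
  unfolding lin_ext_def[of fscale] lin_ext_def[of sc _ t]
  by (simp add: lin_ext_sum[OF assms] lin_ext_scale[OF assms])

text \<open>Both lifts are evaluated on the same chosen representative of \<open>T\<close>, so this
  is an identity between finite sums.\<close>

lemma lin_ext_tensor_lift:
  assumes "vector_space sc"
  shows "lin_ext sc f (tensor_lift fscale g T) = tensor_lift sc (\<lambda>w. lin_ext sc f (g w)) T"
  unfolding tensor_lift_def by (rule lin_ext_lin_ext[OF assms])

lemma formal_tensors_word: "length w = n \<Longrightarrow> word w \<in> formal_tensors n"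
  by (simp add: formal_tensors_def)

lemma subspace_formal_tensors: "module.subspace fscale (formal_tensors n)"
proof -
  interpret fs: vector_space fscale by (rule vector_space_fscale)
  show ?thesis
    unfolding fs.subspace_def formal_tensors_def
    by (force simp: in_keys_iff lookup_add)
qed

context assoc_algebra
begin

lemma vector_space_scale: "vector_space scale"
  by (rule vector_space_axioms)

text \<open>The relators of degree \<open>n\<close> are combinations of words of length
  \<open>n\<close>, so every representative of a class in \<open>tensor_power n\<close> lies in
  \<open>formal_tensors n\<close>. Hence Sweedler sums may be rewritten word by word, for words of
  the right length only, as in \<open>tensor_lift_cong\<close>.\<close>

lemma tensor_rep_length:
  assumes "T \<in> tensor_power n" "w \<in> Poly_Mapping.keys (SOME t. t \<in> T)"
  shows "length w = n"
proof -
  interpret fs: vector_space fscale by (rule vector_space_fscale)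
  obtain t where t: "T = tensor_class n t" "t \<in> formal_tensors n"
    using assms(1) by (auto simp: tensor_power_def)
  let ?s = "SOME t. t \<in> T"
  note sub = subspace_formal_tensors
  have "tensor_relators n \<subseteq> formal_tensors n"
    unfolding tensor_relators_def
    by (auto intro!: fs.subspace_diff[OF sub] fs.subspace_scale[OF sub] formal_tensors_word)
  then have "fs.span (tensor_relators n) \<subseteq> formal_tensors n"
    by (rule fs.span_minimal[OF _ sub])
  moreover have "?s - t \<in> fs.span (tensor_relators n)"
    using tensor_class_rep[of n t] by (simp add: t(1) tensor_class_def)
  ultimately have "(?s - t) + t \<in> formal_tensors n"
    using t(2) fs.subspace_add[OF sub] by blast
  then show ?thesis using assms(2) by (simp add: formal_tensors_def)
qed

lemma tensor_lift_cong:
  assumes "T \<in> tensor_power n" "\<And>w. length w = n \<Longrightarrow> f w = g w"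
  shows "tensor_lift sc f T = tensor_lift sc g T"
  unfolding tensor_lift_def lin_ext_def
  by (rule sum.cong) (auto simp: assms tensor_rep_length[OF assms(1)])

lemma tensor_lift_linear_image:
  assumes "Vector_Spaces.linear scale sc g"
  shows "g (tensor_lift scale f T) = tensor_lift sc (\<lambda>w. g (f w)) T"
proof -
  interpret g: Vector_Spaces.linear scale sc g by fact
  show ?thesis unfolding tensor_lift_def lin_ext_def by (simp add: g.sum g.scale)
qed

lemma tensor_lift_swap:
  "tensor_lift scale (\<lambda>u. tensor_lift scale (f u) R) T =
   tensor_lift scale (\<lambda>v. tensor_lift scale (\<lambda>u. f u v) T) R"
  unfolding tensor_lift_def lin_ext_def scale_sum_right scale_scale
  by (subst sum.swap) (simp only: mult.commute)

lemma linear_tensor_lift: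
  assumes "vector_space sc" "\<And>w. Vector_Spaces.linear sc scale (\<lambda>x. f x w)"
  shows "Vector_Spaces.linear sc scale (\<lambda>x. tensor_lift scale (f x) T)"
  using assms unfolding tensor_lift_def lin_ext_def Vector_Spaces.linear_iff
  by (simp add: scale_right_distrib sum.distrib scale_sum_right mult.commute)

text \<open>The product is the class of an explicit formal combination, and multilinearity of
  \<open>f\<close> allows the lift to be evaluated on that combination. The rules for the other
  tensor operations rest on the same argument.\<close>

lemma tensor_lift_mult:
  assumes "multilinear n scale f"
  shows "tensor_lift scale f (tensor_mult n S T) =
    tensor_lift scale (\<lambda>u. tensor_lift scale (\<lambda>v. f (map2 (*) u v)) T) S"
  unfolding tensor_mult_def
  by (simp add: tensor_lift_class[OF vector_space_scale assms]
    lin_ext_tensor_lift[OF vector_space_scale] vector_space_scale)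

lemma tensor_lift_append:
  assumes "multilinear (m + n) scale f"
  shows "tensor_lift scale f (tensor_append m n S T) =
    tensor_lift scale (\<lambda>u. tensor_lift scale (\<lambda>v. f (u @ v)) T) S"
  unfolding tensor_append_def
  by (simp add: tensor_lift_class[OF vector_space_scale assms]
    lin_ext_tensor_lift[OF vector_space_scale] vector_space_scale)

lemma tensor_lift_comult:
  assumes "multilinear (n + 1) scale f"
  shows "tensor_lift scale f (apply_comult D n i T) =
    tensor_lift scale (\<lambda>w. tensor_lift scale (\<lambda>v. f (take i w @ v @ drop (Suc i) w)) (D (w ! i))) T"
  unfolding apply_comult_def
  by (simp only: tensor_lift_class[OF vector_space_scale assms]
    lin_ext_tensor_lift[OF vector_space_scale] lin_ext_word[OF vector_space_scale])

lemma tensor_lift_counit: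
  assumes "multilinear (n - 1) scale f"
  shows "tensor_lift scale f (apply_counit e n i T) =
    tensor_lift scale (\<lambda>w. scale (e (w ! i)) (f (take i w @ drop (Suc i) w))) T"
  unfolding apply_counit_def
  by (simp only: tensor_lift_class[OF vector_space_scale assms] lin_ext_scale[OF vector_space_scale]
    lin_ext_tensor_lift[OF vector_space_scale] lin_ext_word[OF vector_space_scale])

lemma tensor_lift_one:
  assumes "multilinear n scale f"
  shows "tensor_lift scale f (tensor_one n) = f (replicate n 1)"
  unfolding tensor_one_def pure_tensor_def
  using tensor_lift_class[OF vector_space_scale, of "length (replicate n 1)" f "word (replicate n 1)"] assms
  by (simp add: vector_space_scale)

lemma tensor_lift_add:
  assumes "multilinear n scale f"
  shows "tensor_lift scale f (tensor_add n S T) = tensor_lift scale f S + tensor_lift scale f T"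
  unfolding tensor_add_def
  by (simp add: tensor_lift_class[OF vector_space_scale assms] lin_ext_add[OF vector_space_scale]
    lin_ext_tensor_lift[OF vector_space_scale] vector_space_scale)

lemma tensor_lift_scale:
  assumes "multilinear n scale f"
  shows "tensor_lift scale f (tensor_scale n c T) = scale c (tensor_lift scale f T)"
  unfolding tensor_scale_def
  by (simp add: tensor_lift_class[OF vector_space_scale assms] lin_ext_scale[OF vector_space_scale]
    lin_ext_tensor_lift[OF vector_space_scale] vector_space_scale)

section \<open>Sweedler sums of multilinear functions in up to four variables\<close>

abbreviation endo :: "('h \<Rightarrow> 'h) \<Rightarrow> bool" where
  "endo \<equiv> Vector_Spaces.linear scale scale"

text \<open>
  \<open>sweedler2 T (\<lambda>a b. F a b)\<close> is the Sweedler sum $\sum F(t_1, t_2)$ over $T = \sum t_1 \otimes t_2$.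
\<close>

definition sweedler2 :: "('h, 'k) tensor \<Rightarrow> ('h \<Rightarrow> 'h \<Rightarrow> 'h) \<Rightarrow> 'h" where
  "sweedler2 T f = tensor_lift scale (\<lambda>w. f (w ! 0) (w ! 1)) T"

definition sweedler3 :: "('h, 'k) tensor \<Rightarrow> ('h \<Rightarrow> 'h \<Rightarrow> 'h \<Rightarrow> 'h) \<Rightarrow> 'h" where
  "sweedler3 T f = tensor_lift scale (\<lambda>w. f (w ! 0) (w ! 1) (w ! 2)) T"

definition sweedler4 :: "('h, 'k) tensor \<Rightarrow> ('h \<Rightarrow> 'h \<Rightarrow> 'h \<Rightarrow> 'h \<Rightarrow> 'h) \<Rightarrow> 'h" where
  "sweedler4 T f = tensor_lift scale (\<lambda>w. f (w ! 0) (w ! 1) (w ! 2) (w ! 3)) T"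

lemma endo_iff:
  "endo g \<longleftrightarrow> (\<forall>x y. g (x + y) = g x + g y) \<and> (\<forall>c x. g (scale c x) = scale c (g x))"
  by (simp add: Vector_Spaces.linear_iff vector_space_scale)

definition bilin :: "('h \<Rightarrow> 'h \<Rightarrow> 'h) \<Rightarrow> bool" where
  "bilin f \<longleftrightarrow> (\<forall>y. endo (\<lambda>x. f x y)) \<and> (\<forall>x. endo (\<lambda>y. f x y))"

definition trilin :: "('h \<Rightarrow> 'h \<Rightarrow> 'h \<Rightarrow> 'h) \<Rightarrow> bool" where
  "trilin f \<longleftrightarrow> (\<forall>y z. endo (\<lambda>x. f x y z)) \<and> (\<forall>x z. endo (\<lambda>y. f x y z)) \<and> (\<forall>x y. endo (\<lambda>z. f x y z))"

definition quadrilin :: "('h \<Rightarrow> 'h \<Rightarrow> 'h \<Rightarrow> 'h \<Rightarrow> 'h) \<Rightarrow> bool" where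
  "quadrilin f \<longleftrightarrow> (\<forall>y z w. endo (\<lambda>x. f x y z w)) \<and> (\<forall>x z w. endo (\<lambda>y. f x y z w)) \<and>
     (\<forall>x y w. endo (\<lambda>z. f x y z w)) \<and> (\<forall>x y z. endo (\<lambda>w. f x y z w))"

lemma bilinI:
  "(\<And>y. endo (\<lambda>x. f x y)) \<Longrightarrow> (\<And>x. endo (\<lambda>y. f x y)) \<Longrightarrow> bilin f"
  by (simp add: bilin_def)

lemma trilinI:
  "(\<And>y z. endo (\<lambda>x. f x y z)) \<Longrightarrow> (\<And>x z. endo (\<lambda>y. f x y z)) \<Longrightarrow>
    (\<And>x y. endo (\<lambda>z. f x y z)) \<Longrightarrow> trilin f"
  by (simp add: trilin_def)

lemma quadrilinI:
  "(\<And>y z w. endo (\<lambda>x. f x y z w)) \<Longrightarrow> (\<And>x z w. endo (\<lambda>y. f x y z w)) \<Longrightarrow>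
    (\<And>x y w. endo (\<lambda>z. f x y z w)) \<Longrightarrow> (\<And>x y z. endo (\<lambda>w. f x y z w)) \<Longrightarrow> quadrilin f"
  by (simp add: quadrilin_def)

text \<open>Lists the slots at which \<open>multilinear\<close> tests a word of this length, which
  turns it into linearity in each variable separately.\<close>

lemma length_split_2:
  "length u + 1 + length v = 2 \<longleftrightarrow> (u = [] \<and> (\<exists>a. v = [a])) \<or> ((\<exists>a. u = [a]) \<and> v = [])"
  by (cases u; cases v) auto

lemma length_split_3:
  "length u + 1 + length v = 3 \<longleftrightarrow> (u = [] \<and> (\<exists>a b. v = [a, b])) \<or>
    ((\<exists>a. u = [a]) \<and> (\<exists>b. v = [b])) \<or> ((\<exists>a b. u = [a, b]) \<and> v = [])"
  by (cases u; cases v; cases "tl u"; cases "tl v") auto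

lemma length_split_4:
  "length u + 1 + length v = 4 \<longleftrightarrow> (u = [] \<and> (\<exists>a b c. v = [a, b, c])) \<or>
    ((\<exists>a. u = [a]) \<and> (\<exists>b c. v = [b, c])) \<or> ((\<exists>a b. u = [a, b]) \<and> (\<exists>c. v = [c])) \<or>
    ((\<exists>a b c. u = [a, b, c]) \<and> v = [])"
  by (cases u; cases v; cases "tl u"; cases "tl v"; cases "tl (tl u)"; cases "tl (tl v)") auto

lemma multilinear2: "bilin f \<Longrightarrow> multilinear 2 scale (\<lambda>w. f (w ! 0) (w ! 1))"
  unfolding multilinear_def length_split_2 bilin_def endo_iff by auto

lemma multilinear3: "trilin f \<Longrightarrow> multilinear 3 scale (\<lambda>w. f (w ! 0) (w ! 1) (w ! 2))"
  unfolding multilinear_def length_split_3 trilin_def endo_iff by auto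

lemma multilinear4: "quadrilin f \<Longrightarrow> multilinear 4 scale (\<lambda>w. f (w ! 0) (w ! 1) (w ! 2) (w ! 3))"
  unfolding multilinear_def length_split_4 quadrilin_def endo_iff
  by (auto simp: numeral_2_eq_2 numeral_3_eq_3)

lemma endo_ident: "endo (\<lambda>x. x)"
  by (simp add: endo_iff)

lemma endo_mult_left: "endo g \<Longrightarrow> endo (\<lambda>x. a * g x)"
  by (simp add: endo_iff algebra_simps scale_mult_right)

lemma endo_mult_right: "endo g \<Longrightarrow> endo (\<lambda>x. g x * a)"
  by (simp add: endo_iff algebra_simps scale_mult_left)

lemma endo_scale: "endo g \<Longrightarrow> endo (\<lambda>x. scale c (g x))"
  by (simp add: endo_iff algebra_simps)

lemma endo_sum: "(\<And>i. endo (\<lambda>x. f x i)) \<Longrightarrow> endo (\<lambda>x. sum (f x) I)"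
  by (simp add: endo_iff sum.distrib scale_sum_right)

lemma endo_sweedler2: "(\<And>a b. endo (\<lambda>x. f x a b)) \<Longrightarrow> endo (\<lambda>x. sweedler2 T (f x))"
  unfolding sweedler2_def by (rule linear_tensor_lift[OF vector_space_scale])

lemma endo_sweedler3: "(\<And>a b c. endo (\<lambda>x. f x a b c)) \<Longrightarrow> endo (\<lambda>x. sweedler3 T (f x))"
  unfolding sweedler3_def by (rule linear_tensor_lift[OF vector_space_scale])

lemma endo_sweedler4: "(\<And>a b c d. endo (\<lambda>x. f x a b c d)) \<Longrightarrow> endo (\<lambda>x. sweedler4 T (f x))"
  unfolding sweedler4_def by (rule linear_tensor_lift[OF vector_space_scale])

lemma sweedler2_sum: "sweedler2 T (\<lambda>a b. \<Sum>i\<in>I. f i a b) = (\<Sum>i\<in>I. sweedler2 T (f i))"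
  unfolding sweedler2_def tensor_lift_def lin_ext_def scale_sum_right by (rule sum.swap)

lemma sweedler2_linear_image: "endo g \<Longrightarrow> g (sweedler2 T f) = sweedler2 T (\<lambda>a b. g (f a b))"
  unfolding sweedler2_def by (rule tensor_lift_linear_image)

lemma sweedler3_linear_image: "endo g \<Longrightarrow> g (sweedler3 T f) = sweedler3 T (\<lambda>a b c. g (f a b c))"
  unfolding sweedler3_def by (rule tensor_lift_linear_image)

lemma sweedler23_swap:
  "sweedler2 T (\<lambda>a b. sweedler3 R (\<lambda>c d e. f a b c d e)) = sweedler3 R (\<lambda>c d e. sweedler2 T (\<lambda>a b. f a b c d e))"
  unfolding sweedler2_def sweedler3_def by (rule tensor_lift_swap)

section \<open>Closure of tensor powers under the tensor operations\<close>

lemma tensor_lift_formal: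
  assumes "T \<in> tensor_power m" "\<And>w. length w = m \<Longrightarrow> f w \<in> formal_tensors n"
  shows "tensor_lift fscale f T \<in> formal_tensors n"
proof -
  interpret fs: vector_space fscale by (rule vector_space_fscale)
  note sub = subspace_formal_tensors[of n]
  show ?thesis unfolding tensor_lift_def lin_ext_def
    by (intro fs.subspace_sum[OF sub] fs.subspace_scale[OF sub] assms(2) tensor_rep_length[OF assms(1)])
qed

lemma tensor_mult_closed:
  "S \<in> tensor_power n \<Longrightarrow> T \<in> tensor_power n \<Longrightarrow> tensor_mult n S T \<in> tensor_power n"
  unfolding tensor_mult_def tensor_power_def[of n]
  by (intro imageI tensor_lift_formal[where m = n] formal_tensors_word)
    (auto simp: tensor_power_def)

lemma tensor_append_closed:
  "S \<in> tensor_power m \<Longrightarrow> T \<in> tensor_power n \<Longrightarrow> tensor_append m n S T \<in> tensor_power (m + n)"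
  unfolding tensor_append_def tensor_power_def[of "m + n"]
  by (intro imageI tensor_lift_formal[where m = m] tensor_lift_formal[where m = n] formal_tensors_word) auto

lemma apply_comult_closed:
  "T \<in> tensor_power n \<Longrightarrow> (\<And>x. D x \<in> tensor_power 2) \<Longrightarrow> i < n \<Longrightarrow>
    apply_comult D n i T \<in> tensor_power (n + 1)"
  unfolding apply_comult_def tensor_power_def[of "n + 1"]
  by (intro imageI tensor_lift_formal[where m = n] tensor_lift_formal[where m = 2] formal_tensors_word) auto

lemma tensor_one_closed: "tensor_one n \<in> tensor_power n"
  unfolding tensor_one_def pure_tensor_def tensor_power_def
  by (simp add: formal_tensors_word)

section \<open>Evaluation of Sweedler sums on sums, products, coproducts and units\<close>

lemma sweedler2_add: "bilin f \<Longrightarrow> sweedler2 (tensor_add 2 S T) f = sweedler2 S f + sweedler2 T f"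
  unfolding sweedler2_def by (rule tensor_lift_add[OF multilinear2])

lemma sweedler2_scale: "bilin f \<Longrightarrow> sweedler2 (tensor_scale 2 c T) f = scale c (sweedler2 T f)"
  unfolding sweedler2_def by (rule tensor_lift_scale[OF multilinear2])

lemma sweedler2_one: "bilin f \<Longrightarrow> sweedler2 (tensor_one 2) f = f 1 1"
  unfolding sweedler2_def by (subst tensor_lift_one[OF multilinear2]) auto

lemma sweedler3_one: "trilin f \<Longrightarrow> sweedler3 (tensor_one 3) f = f 1 1 1"
  unfolding sweedler3_def by (subst tensor_lift_one[OF multilinear3]) auto

lemma sweedler2_mult:
  assumes "bilin f" "S \<in> tensor_power 2" "T \<in> tensor_power 2"
  shows "sweedler2 (tensor_mult 2 S T) f = sweedler2 S (\<lambda>a b. sweedler2 T (\<lambda>c d. f (a * c) (b * d)))"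
  unfolding sweedler2_def tensor_lift_mult[OF multilinear2[OF assms(1)]]
  by (intro tensor_lift_cong[OF assms(2)] tensor_lift_cong[OF assms(3)]) simp

lemma sweedler3_mult:
  assumes "trilin f" "S \<in> tensor_power 3" "T \<in> tensor_power 3"
  shows "sweedler3 (tensor_mult 3 S T) f =
    sweedler3 S (\<lambda>a b c. sweedler3 T (\<lambda>a' b' c'. f (a * a') (b * b') (c * c')))"
  unfolding sweedler3_def tensor_lift_mult[OF multilinear3[OF assms(1)]]
  by (intro tensor_lift_cong[OF assms(2)] tensor_lift_cong[OF assms(3)]) simp

lemma sweedler4_mult:
  assumes "quadrilin f" "S \<in> tensor_power 4" "T \<in> tensor_power 4"
  shows "sweedler4 (tensor_mult 4 S T) f =
    sweedler4 S (\<lambda>a b c d. sweedler4 T (\<lambda>a' b' c' d'. f (a * a') (b * b') (c * c') (d * d')))"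
  unfolding sweedler4_def tensor_lift_mult[OF multilinear4[OF assms(1)]]
  by (intro tensor_lift_cong[OF assms(2)] tensor_lift_cong[OF assms(3)]) simp

lemma length_2: "length w = 2 \<longleftrightarrow> (\<exists>a b. w = [a, b])"
  by (simp add: numeral_2_eq_2 length_Suc_conv) blast

lemma length_3: "length w = 3 \<longleftrightarrow> (\<exists>a b c. w = [a, b, c])"
  by (simp add: numeral_3_eq_3 length_Suc_conv) blast

context
  fixes D :: "'h \<Rightarrow> ('h, 'k) tensor"
  assumes D: "\<And>x. D x \<in> tensor_power 2"
begin

text \<open>The chosen representatives of \<open>D a\<close> and \<open>T\<close> consist of words
  of length 2, so inserting one word into the other puts the letters at the expected
  positions.\<close>

lemma sweedler3_comult0:
  assumes "trilin f" "T \<in> tensor_power 2"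
  shows "sweedler3 (apply_comult D 2 0 T) f = sweedler2 T (\<lambda>a b. sweedler2 (D a) (\<lambda>c d. f c d b))"
  unfolding sweedler3_def sweedler2_def
  by (subst tensor_lift_comult[of 2], use multilinear3[OF assms(1)] in simp)
    (intro tensor_lift_cong[OF assms(2)] tensor_lift_cong[OF D], auto simp: length_2)

lemma sweedler3_comult1:
  assumes "trilin f" "T \<in> tensor_power 2"
  shows "sweedler3 (apply_comult D 2 1 T) f = sweedler2 T (\<lambda>a b. sweedler2 (D b) (\<lambda>c d. f a c d))"
  unfolding sweedler3_def sweedler2_def
  by (subst tensor_lift_comult[of 2], use multilinear3[OF assms(1)] in simp)
    (intro tensor_lift_cong[OF assms(2)] tensor_lift_cong[OF D], auto simp: length_2)

lemma sweedler4_comult0: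
  assumes "quadrilin f" "T \<in> tensor_power 3"
  shows "sweedler4 (apply_comult D 3 0 T) f = sweedler3 T (\<lambda>a b c. sweedler2 (D a) (\<lambda>x y. f x y b c))"
  unfolding sweedler4_def sweedler3_def sweedler2_def
  by (subst tensor_lift_comult[of 3], use multilinear4[OF assms(1)] in simp)
    (intro tensor_lift_cong[OF assms(2)] tensor_lift_cong[OF D], auto simp: length_2 length_3)

lemma sweedler4_comult1:
  assumes "quadrilin f" "T \<in> tensor_power 3"
  shows "sweedler4 (apply_comult D 3 1 T) f = sweedler3 T (\<lambda>a b c. sweedler2 (D b) (\<lambda>x y. f a x y c))"
  unfolding sweedler4_def sweedler3_def sweedler2_def
  by (subst tensor_lift_comult[of 3], use multilinear4[OF assms(1)] in simp)
    (intro tensor_lift_cong[OF assms(2)] tensor_lift_cong[OF D], auto simp: length_2 length_3)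

lemma sweedler4_comult2:
  assumes "quadrilin f" "T \<in> tensor_power 3"
  shows "sweedler4 (apply_comult D 3 2 T) f = sweedler3 T (\<lambda>a b c. sweedler2 (D c) (\<lambda>x y. f a b x y))"
  unfolding sweedler4_def sweedler3_def sweedler2_def
  by (subst tensor_lift_comult[of 3], use multilinear4[OF assms(1)] in simp)
    (intro tensor_lift_cong[OF assms(2)] tensor_lift_cong[OF D], auto simp: length_2 length_3)

end

lemma tensor_lift_one_1:
  assumes "endo f"
  shows "tensor_lift scale (\<lambda>u. f (u ! 0)) (tensor_one 1) = f 1"
proof -
  have "multilinear 1 scale (\<lambda>u. f (u ! 0))"
    using assms unfolding multilinear_def endo_iff by auto
  from tensor_lift_one[OF this] show ?thesis by simp
qed

lemma sweedler4_one_append: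
  assumes "quadrilin f" "T \<in> tensor_power 3"
  shows "sweedler4 (tensor_append 1 3 (tensor_one 1) T) f = sweedler3 T (\<lambda>a b c. f 1 a b c)"
proof -
  have "sweedler4 (tensor_append 1 3 (tensor_one 1) T) f =
    tensor_lift scale (\<lambda>u. sweedler3 T (\<lambda>a b c. f (u ! 0) a b c)) (tensor_one 1)"
    unfolding sweedler4_def sweedler3_def
    by (subst tensor_lift_append, use multilinear4[OF assms(1)] in simp)
      (intro tensor_lift_cong[OF tensor_one_closed] tensor_lift_cong[OF assms(2)],
        auto simp: length_Suc_conv length_3 numeral_3_eq_3)
  also have "\<dots> = sweedler3 T (\<lambda>a b c. f 1 a b c)"
    using assms(1) by (intro tensor_lift_one_1 endo_sweedler3) (simp add: quadrilin_def)
  finally show ?thesis .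
qed

lemma sweedler4_append_one:
  assumes "quadrilin f" "T \<in> tensor_power 3"
  shows "sweedler4 (tensor_append 3 1 T (tensor_one 1)) f = sweedler3 T (\<lambda>a b c. f a b c 1)"
proof -
  have "sweedler4 (tensor_append 3 1 T (tensor_one 1)) f =
    sweedler3 T (\<lambda>a b c. tensor_lift scale (\<lambda>u. f a b c (u ! 0)) (tensor_one 1))"
    unfolding sweedler4_def sweedler3_def
    by (subst tensor_lift_append, use multilinear4[OF assms(1)] in simp)
      (intro tensor_lift_cong[OF tensor_one_closed] tensor_lift_cong[OF assms(2)],
        auto simp: length_Suc_conv length_3 numeral_3_eq_3)
  also have "\<dots> = sweedler3 T (\<lambda>a b c. f a b c 1)"
    using assms(1) by (subst tensor_lift_one_1) (simp_all add: quadrilin_def)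
  finally show ?thesis .
qed

lemma sweedler2_counit:
  assumes "bilin f" "T \<in> tensor_power 3"
  shows "sweedler2 (apply_counit e 3 1 T) f = sweedler3 T (\<lambda>a b c. scale (e b) (f a c))"
  unfolding sweedler3_def sweedler2_def
  by (subst tensor_lift_counit, use multilinear2[OF assms(1)] in simp)
    (intro tensor_lift_cong[OF assms(2)], auto simp: length_3)

end


section \<open>Sweedler calculus in quasi-Hopf algebras\<close>

context quasi_bialgebra
begin

text \<open>The fixed vector \<open>c\<close> turns the linear form \<epsilon> into a linear map
  with values in the algebra, as \<open>endo\<close> demands. The same device serves for coordinates
  in \<open>endo_coord\<close>.\<close>

lemma endo_counit: "endo g \<Longrightarrow> endo (\<lambda>x. scale (\<epsilon> (g x)) c)"
  by (simp add: endo_iff counit_add counit_scale scale_left_distrib)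

lemma endo_comult: "endo g \<Longrightarrow> bilin f \<Longrightarrow> endo (\<lambda>x. sweedler2 (\<Delta> (g x)) f)"
  by (simp add: endo_iff comult_add comult_scale sweedler2_add sweedler2_scale)

text \<open>These rules follow the syntax of an expression, so repeated application discharges the
  linearity conditions of the Sweedler identities below.\<close>

lemmas endo_intros = endo_ident endo_mult_left endo_mult_right endo_scale endo_sum endo_sweedler2
  endo_sweedler3 endo_sweedler4 endo_counit endo_comult

lemmas multilinear_intros = bilinI trilinI quadrilinI endo_intros

lemma bilin_endo1: "bilin f \<Longrightarrow> endo g \<Longrightarrow> endo (\<lambda>x. f (g x) y)"
  by (simp add: bilin_def endo_iff)

lemma bilin_endo2: "bilin f \<Longrightarrow> endo g \<Longrightarrow> endo (\<lambda>x. f y (g x))"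
  by (simp add: bilin_def endo_iff)

lemma trilin_endo1: "trilin f \<Longrightarrow> endo g \<Longrightarrow> endo (\<lambda>x. f (g x) y z)"
  by (simp add: trilin_def endo_iff)

lemma trilin_endo2: "trilin f \<Longrightarrow> endo g \<Longrightarrow> endo (\<lambda>x. f y (g x) z)"
  by (simp add: trilin_def endo_iff)

lemma trilin_endo3: "trilin f \<Longrightarrow> endo g \<Longrightarrow> endo (\<lambda>x. f y z (g x))"
  by (simp add: trilin_def endo_iff)

lemma sweedler2_comult_one: "bilin f \<Longrightarrow> sweedler2 (\<Delta> 1) f = f 1 1"
  by (simp add: comult_one sweedler2_one)

lemma sweedler2_comult_mult:
  "bilin f \<Longrightarrow> sweedler2 (\<Delta> (x * y)) f =
    sweedler2 (\<Delta> x) (\<lambda>a b. sweedler2 (\<Delta> y) (\<lambda>c d. f (a * c) (b * d)))"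
  by (simp add: comult_mult sweedler2_mult comult_closed)

lemma sweedler2_counit_right:
  assumes "endo g"
  shows "sweedler2 (\<Delta> h) (\<lambda>a b. scale (\<epsilon> b) (g a)) = g h"
proof -
  have "g (sweedler2 (\<Delta> h) (\<lambda>a b. scale (\<epsilon> b) a)) = sweedler2 (\<Delta> h) (\<lambda>a b. g (scale (\<epsilon> b) a))"
    by (rule sweedler2_linear_image[OF assms])
  moreover have "sweedler2 (\<Delta> h) (\<lambda>a b. scale (\<epsilon> b) a) = h"
    unfolding sweedler2_def by (rule counit_right)
  ultimately show ?thesis using assms by (simp add: endo_iff)
qed

lemma sweedler2_counit_left:
  assumes "endo g"
  shows "sweedler2 (\<Delta> h) (\<lambda>a b. scale (\<epsilon> a) (g b)) = g h"
proof -
  have "g (sweedler2 (\<Delta> h) (\<lambda>a b. scale (\<epsilon> a) b)) = sweedler2 (\<Delta> h) (\<lambda>a b. g (scale (\<epsilon> a) b))"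
    by (rule sweedler2_linear_image[OF assms])
  moreover have "sweedler2 (\<Delta> h) (\<lambda>a b. scale (\<epsilon> a) b) = h"
    unfolding sweedler2_def by (rule counit_left)
  ultimately show ?thesis using assms by (simp add: endo_iff)
qed

lemma sweedler3_assoc_counit:
  assumes "bilin f"
  shows "sweedler3 \<Phi> (\<lambda>a b c. scale (\<epsilon> b) (f a c)) = f 1 1"
  using sweedler2_counit[OF assms assoc_closed, of \<epsilon>] sweedler2_one[OF assms]
  by (simp only: assoc_counit)

lemma sweedler3_assoc_right_inv:
  assumes "trilin f"
  shows "sweedler3 \<Phi> (\<lambda>a b c. sweedler3 \<Phi>i (\<lambda>a' b' c'. f (a * a') (b * b') (c * c'))) = f 1 1 1"
  using sweedler3_mult[OF assms assoc_closed assoc_inv_closed] sweedler3_one[OF assms]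
  by (simp add: assoc_right_inv)

lemma sweedler3_assoc_left_inv:
  assumes "trilin f"
  shows "sweedler3 \<Phi>i (\<lambda>a b c. sweedler3 \<Phi> (\<lambda>a' b' c'. f (a * a') (b * b') (c * c'))) = f 1 1 1"
  using sweedler3_mult[OF assms assoc_inv_closed assoc_closed] sweedler3_one[OF assms]
  by (simp add: assoc_left_inv)

text \<open>Quasi-coassociativity multiplied by \<Phi> on the right, so that \<open>\<Phi>i\<close>
  disappears, and evaluated under \<open>f\<close>.\<close>

lemma sweedler_coassoc:
  assumes f: "trilin f"
  shows "sweedler3 \<Phi> (\<lambda>x y z. sweedler2 (\<Delta> h) (\<lambda>a b. sweedler2 (\<Delta> b) (\<lambda>c d. f (a * x) (c * y) (d * z)))) =
    sweedler3 \<Phi> (\<lambda>x y z. sweedler2 (\<Delta> h) (\<lambda>a b. sweedler2 (\<Delta> a) (\<lambda>c d. f (x * c) (y * d) (z * b))))"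
proof -
  note intros = multilinear_intros trilin_endo1[OF f] trilin_endo2[OF f] trilin_endo3[OF f]
  \<comment> \<open>Evaluating \<open>g\<close> on a tensor amounts to multiplying it by \<Phi> on
    the right and evaluating \<open>f\<close>; this \<Phi> will cancel the \<open>\<Phi>i\<close> of
    the axiom.\<close>
  define g where "g = (\<lambda>p q r. sweedler3 \<Phi> (\<lambda>x y z. f (p * x) (q * y) (r * z)))"
  have g: "trilin g" unfolding g_def by (intro intros)
  have cl: "apply_comult \<Delta> 2 0 (\<Delta> h) \<in> tensor_power 3" "apply_comult \<Delta> 2 1 (\<Delta> h) \<in> tensor_power 3"
    using apply_comult_closed[OF comult_closed[of h], of \<Delta>] comult_closed by simp_all
  note cl = cl tensor_mult_closed assoc_closed assoc_inv_closed
  let ?A = "apply_comult \<Delta> 2 0 (\<Delta> h)"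
  have "sweedler2 (\<Delta> h) (\<lambda>a b. sweedler2 (\<Delta> b) (\<lambda>c d. g a c d)) =
      sweedler3 (apply_comult \<Delta> 2 1 (\<Delta> h)) g"
    by (simp only: sweedler3_comult1[OF comult_closed g comult_closed])
  also have "\<dots> = sweedler3 (tensor_mult 3 \<Phi> ?A) (\<lambda>a b c. sweedler3 \<Phi>i (\<lambda>a' b' c'. g (a * a') (b * b') (c * c')))"
    by (simp only: quasi_coassoc sweedler3_mult[OF g] cl)
  also have "\<dots> = sweedler3 (tensor_mult 3 \<Phi> ?A) f"
  proof (rule arg_cong[of _ _ "sweedler3 _"], intro ext)
    fix a b c
    have "sweedler3 \<Phi>i (\<lambda>a' b' c'. sweedler3 \<Phi> (\<lambda>x y z. f (a * (a' * x)) (b * (b' * y)) (c * (c' * z)))) =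
        f (a * 1) (b * 1) (c * 1)"
      by (rule sweedler3_assoc_left_inv) (intro intros)
    then show "sweedler3 \<Phi>i (\<lambda>a' b' c'. g (a * a') (b * b') (c * c')) = f a b c"
      by (simp add: g_def mult.assoc)
  qed
  also have "\<dots> = sweedler3 \<Phi> (\<lambda>x y z. sweedler3 ?A (\<lambda>a b c. f (x * a) (y * b) (z * c)))"
    by (simp add: sweedler3_mult[OF f] cl)
  also have "\<dots> = sweedler3 \<Phi> (\<lambda>x y z. sweedler2 (\<Delta> h) (\<lambda>a b. sweedler2 (\<Delta> a) (\<lambda>c d. f (x * c) (y * d) (z * b))))"
    by (subst sweedler3_comult0[OF comult_closed _ comult_closed]) (intro intros, rule refl)
  finally show ?thesis unfolding g_def sweedler23_swap .
qed

text \<open>The pentagon axiom with products and coproducts expanded. On the left, the letters x, y,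
  z belong to 1 \<otimes> \<Phi>, to \<Phi> with \<Delta> on its middle leg, and to \<Phi> \<otimes>
  1; on the right, x and y belong to \<Phi> with \<Delta> on its third and on its first leg.\<close>

lemma sweedler_pentagon:
  assumes f: "quadrilin f"
  shows "sweedler3 \<Phi> (\<lambda>x1 x2 x3. sweedler3 \<Phi> (\<lambda>y1 y2 y3. sweedler2 (\<Delta> y2) (\<lambda>u v. sweedler3 \<Phi> (\<lambda>z1 z2 z3.
      f (y1 * z1) (x1 * u * z2) (x2 * v * z3) (x3 * y3))))) =
    sweedler3 \<Phi> (\<lambda>x1 x2 x3. sweedler2 (\<Delta> x3) (\<lambda>u v. sweedler3 \<Phi> (\<lambda>y1 y2 y3. sweedler2 (\<Delta> y1) (\<lambda>p q.
      f (x1 * p) (x2 * q) (u * y2) (v * y3)))))"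
    (is "?L = ?R")
proof -
  have lin: "endo (\<lambda>x. f (g x) a b c)" "endo (\<lambda>x. f a (g x) b c)" "endo (\<lambda>x. f a b (g x) c)"
    "endo (\<lambda>x. f a b c (g x))" if "endo g" for a b c g
    using f that by (simp_all add: quadrilin_def endo_iff)
  note intros = multilinear_intros lin
  let ?A = "tensor_append 1 3 (tensor_one 1) \<Phi>" and ?B = "apply_comult \<Delta> 3 1 \<Phi>"
    and ?C = "tensor_append 3 1 \<Phi> (tensor_one 1)"
    and ?D = "apply_comult \<Delta> 3 2 \<Phi>" and ?E = "apply_comult \<Delta> 3 0 \<Phi>"
  have A: "?A \<in> tensor_power 4" and C: "?C \<in> tensor_power 4"
    using tensor_append_closed[OF tensor_one_closed[of 1] assoc_closed]
      tensor_append_closed[OF assoc_closed tensor_one_closed[of 1]] by simp_all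
  have "apply_comult \<Delta> 3 i \<Phi> \<in> tensor_power 4" if "i < 3" for i
    using apply_comult_closed[OF assoc_closed comult_closed that] by simp
  then have B: "?B \<in> tensor_power 4" and D: "?D \<in> tensor_power 4" and E: "?E \<in> tensor_power 4"
    by simp_all
  have "?L = sweedler4 ?A (\<lambda>x0 x1 x2 x3. sweedler4 ?B (\<lambda>y1 u v y3. sweedler3 \<Phi> (\<lambda>z1 z2 z3.
      f (x0 * y1 * z1) (x1 * u * z2) (x2 * v * z3) (x3 * y3 * 1))))"
    by (subst sweedler4_one_append[OF _ assoc_closed], (intro intros)[1],
        subst sweedler4_comult1[OF comult_closed _ assoc_closed], (intro intros)[1], simp)
  also have "\<dots> = sweedler4 (tensor_mult 4 ?A ?B)
      (\<lambda>a b c d. sweedler3 \<Phi> (\<lambda>z1 z2 z3. f (a * z1) (b * z2) (c * z3) (d * 1)))"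
    by (rule sweedler4_mult[symmetric, OF _ A B]) (intro intros)
  also have "\<dots> = sweedler4 (tensor_mult 4 (tensor_mult 4 ?A ?B) ?C) f"
    by (subst sweedler4_mult[OF f tensor_mult_closed[OF A B] C],
        subst sweedler4_append_one[OF _ assoc_closed], intro intros, rule refl)
  also have "\<dots> = sweedler4 (tensor_mult 4 ?D ?E) f"
    by (simp only: pentagon)
  also have "\<dots> = ?R"
    by (subst sweedler4_mult[OF f D E],
        subst sweedler4_comult2[OF comult_closed _ assoc_closed], (intro intros)[1],
        subst sweedler4_comult0[OF comult_closed _ assoc_closed], (intro intros)[1], rule refl)
  finally show ?thesis .
qed

text \<open>
  Apply \<open>\<epsilon>\<close> to the second factor of the pentagon equation, and cancel \<open>\<Phi>\<close>.
\<close>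

lemma sweedler3_assoc_counit_left:
  assumes f: "bilin f"
  shows "sweedler3 \<Phi> (\<lambda>a b c. scale (\<epsilon> a) (f b c)) = f 1 1"
proof -
  note intros = multilinear_intros bilin_endo1[OF f] bilin_endo2[OF f]
  have scale_sweedler3: "scale c (sweedler3 T g) = sweedler3 T (\<lambda>x y z. scale c (g x y z))" for c T g
    by (rule sweedler3_linear_image) (intro endo_intros)
  have scale_sweedler2: "scale c (sweedler2 T g) = sweedler2 T (\<lambda>x y. scale c (g x y))" for c T g
    by (rule sweedler2_linear_image) (intro endo_intros)
  \<comment> \<open>\<open>F\<close> applies \<epsilon> to the second argument, multiplies the other
    three by \<open>\<Phi>i\<close> on the right, and then applies \<epsilon> to the first of them
    and \<open>f\<close> to the last two.\<close>
  define F where "F = (\<lambda>a b c d. scale (\<epsilon> b) (sweedler3 \<Phi>i (\<lambda>y1 y2 y3. scale (\<epsilon> (a * y1)) (f (c * y2) (d * y3)))))"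
  have F: "quadrilin F" unfolding F_def by (intro intros)
  have lin: "endo (\<lambda>x. F (g x) a b c)" "endo (\<lambda>x. F a (g x) b c)" "endo (\<lambda>x. F a b (g x) c)"
    "endo (\<lambda>x. F a b c (g x))" if "endo g" for a b c g
    using F that by (simp_all add: quadrilin_def endo_iff)
  note intros = intros lin
  have cancel: "sweedler3 \<Phi> (\<lambda>y1 y2 y3. F y1 1 (x2 * y2) (x3 * y3)) = f x2 x3" for x2 x3
  proof -
    have "sweedler3 \<Phi> (\<lambda>y1 y2 y3. F y1 1 (x2 * y2) (x3 * y3)) =
      sweedler3 \<Phi> (\<lambda>a b c. sweedler3 \<Phi>i (\<lambda>a' b' c'.
        scale (\<epsilon> (a * a')) (f (x2 * (b * b')) (x3 * (c * c')))))"
      by (simp add: F_def counit_one mult.assoc)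
    also have "\<dots> = scale (\<epsilon> 1) (f (x2 * 1) (x3 * 1))"
      by (rule sweedler3_assoc_right_inv) (intro intros)
    finally show ?thesis by (simp add: counit_one)
  qed
  have F_mult: "F a (b * c) d e = scale (\<epsilon> c) (F a b d e)" for a b c d e
    by (simp add: F_def counit_mult mult.commute)
  have F1: "F a b d e = scale (\<epsilon> b) (F a 1 d e)" for a b d e
    by (simp add: F_def counit_one)
  have "sweedler3 \<Phi> (\<lambda>a b c. scale (\<epsilon> a) (f b c)) =
    sweedler3 \<Phi> (\<lambda>x1 x2 x3. sweedler3 \<Phi> (\<lambda>y1 y2 y3. scale (\<epsilon> x1) (F y1 1 (x2 * y2) (x3 * y3))))"
    by (simp add: scale_sweedler3[symmetric] cancel)
  \<comment> \<open>The left side of the pentagon is rebuilt here and in the next step: first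
    \<open>y2\<close> is split by the counit axiom, then a third copy of \<Phi>, trivial under
    \<epsilon> on its middle leg, is inserted.\<close>
  also have "\<dots> = sweedler3 \<Phi> (\<lambda>x1 x2 x3. sweedler3 \<Phi> (\<lambda>y1 y2 y3. sweedler2 (\<Delta> y2) (\<lambda>u v.
      scale (\<epsilon> u) (F y1 x1 (x2 * v) (x3 * y3)))))"
    by (subst sweedler2_counit_left, intro intros) (subst (2) F1, rule refl)
  also have "\<dots> = sweedler3 \<Phi> (\<lambda>x1 x2 x3. sweedler3 \<Phi> (\<lambda>y1 y2 y3. sweedler2 (\<Delta> y2) (\<lambda>u v. sweedler3 \<Phi> (\<lambda>z1 z2 z3.
      F (y1 * z1) (x1 * u * z2) (x2 * v * z3) (x3 * y3)))))"
    by (subst F_mult, subst sweedler3_assoc_counit, (intro intros)[1]) (simp add: F_mult)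
  also have "\<dots> = sweedler3 \<Phi> (\<lambda>x1 x2 x3. sweedler2 (\<Delta> x3) (\<lambda>u v. sweedler3 \<Phi> (\<lambda>y1 y2 y3. sweedler2 (\<Delta> y1) (\<lambda>p q.
      F (x1 * p) (x2 * q) (u * y2) (v * y3)))))"
    by (rule sweedler_pentagon[OF F])
  \<comment> \<open>On the right side \<epsilon> collapses the coproduct of \<open>y1\<close>. What
    is left is \<epsilon> on the middle leg of the outer \<Phi>, which then becomes 1 \<otimes> 1,
    while the inner \<Phi> cancels inside \<open>F\<close>.\<close>
  also have "\<dots> = sweedler3 \<Phi> (\<lambda>x1 x2 x3. scale (\<epsilon> x2) (sweedler2 (\<Delta> x3) (\<lambda>u v. sweedler3 \<Phi> (\<lambda>y1 y2 y3.
      F (x1 * y1) 1 (u * y2) (v * y3)))))"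
  proof -
    have "sweedler2 (\<Delta> y1) (\<lambda>p q. F (x1 * p) (x2 * q) a b) = scale (\<epsilon> x2) (F (x1 * y1) 1 a b)" for y1 x1 x2 a b
      by (subst F_mult, subst sweedler2_counit_right, (intro intros)[1], rule F1)
    then show ?thesis by (simp add: scale_sweedler2 scale_sweedler3)
  qed
  also have "\<dots> = sweedler2 (\<Delta> 1) (\<lambda>u v. sweedler3 \<Phi> (\<lambda>y1 y2 y3. F (1 * y1) 1 (u * y2) (v * y3)))"
    by (rule sweedler3_assoc_counit) (intro intros)
  also have "\<dots> = sweedler2 (\<Delta> 1) f"
    by (simp add: cancel)
  also have "\<dots> = f 1 1"
    by (rule sweedler2_comult_one[OF f])
  finally show ?thesis .
qed

end

context quasi_hopf_algebra
begin

lemma endo_antipode: "endo g \<Longrightarrow> endo (\<lambda>x. S (g x))"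
  by (simp add: endo_iff antipode_add antipode_scale)

lemma sweedler2_antipode_left:
  assumes "endo g"
  shows "sweedler2 (\<Delta> h) (\<lambda>a b. g (S a * \<alpha> * b)) = scale (\<epsilon> h) (g \<alpha>)"
proof -
  have "g (sweedler2 (\<Delta> h) (\<lambda>a b. S a * \<alpha> * b)) = sweedler2 (\<Delta> h) (\<lambda>a b. g (S a * \<alpha> * b))"
    by (rule sweedler2_linear_image[OF assms])
  moreover have "sweedler2 (\<Delta> h) (\<lambda>a b. S a * \<alpha> * b) = scale (\<epsilon> h) \<alpha>"
    unfolding sweedler2_def by (rule antipode_left)
  ultimately show ?thesis using assms by (simp add: endo_iff)
qed

lemma sweedler2_antipode_right:
  assumes "endo g"
  shows "sweedler2 (\<Delta> h) (\<lambda>a b. g (a * \<beta> * S b)) = scale (\<epsilon> h) (g \<beta>)"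
proof -
  have "g (sweedler2 (\<Delta> h) (\<lambda>a b. a * \<beta> * S b)) = sweedler2 (\<Delta> h) (\<lambda>a b. g (a * \<beta> * S b))"
    by (rule sweedler2_linear_image[OF assms])
  moreover have "sweedler2 (\<Delta> h) (\<lambda>a b. a * \<beta> * S b) = scale (\<epsilon> h) \<beta>"
    unfolding sweedler2_def by (rule antipode_right)
  ultimately show ?thesis using assms by (simp add: endo_iff)
qed

lemma sweedler3_antipode:
  assumes "endo g"
  shows "sweedler3 \<Phi> (\<lambda>x y z. g (x * \<beta> * S y * \<alpha> * z)) = g 1"
proof -
  have "g (sweedler3 \<Phi> (\<lambda>x y z. x * \<beta> * S y * \<alpha> * z)) = sweedler3 \<Phi> (\<lambda>x y z. g (x * \<beta> * S y * \<alpha> * z))"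
    by (rule sweedler3_linear_image[OF assms])
  moreover have "sweedler3 \<Phi> (\<lambda>x y z. x * \<beta> * S y * \<alpha> * z) = 1"
    unfolding sweedler3_def by (rule antipode_assoc)
  ultimately show ?thesis by simp
qed

lemma sweedler2_comult_scale:
  "bilin f \<Longrightarrow> sweedler2 (\<Delta> (scale c x)) f = scale c (sweedler2 (\<Delta> x) f)"
  by (simp add: comult_scale sweedler2_scale)

section \<open>Maschke's theorem for a normalized left integral\<close>

text \<open>Averaging a linear projection onto a left ideal by \<open>t\<close> and correcting the
  result with \<Phi> gives a projection \<open>p\<close> onto the ideal that is linear over the
  algebra. Its kernel is the complement.\<close>

lemma semisimple_if_normalized_integral:
  assumes integral: "\<And>h. h * t = scale (\<epsilon> h) t" and "\<epsilon> t = 1"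
  shows "semisimple_ring TYPE('h)"
  unfolding semisimple_ring_def semisimple_module_def
proof (intro allI impI)
  fix U :: "'h set"
  assume U: "submodule (*) U"
  have U0: "0 \<in> U" and U_add: "\<And>x y. x \<in> U \<Longrightarrow> y \<in> U \<Longrightarrow> x + y \<in> U"
    and U_mult: "\<And>h x. x \<in> U \<Longrightarrow> h * x \<in> U"
    using U by (auto simp: submodule_def)
  have U_scale: "scale c x \<in> U" if "x \<in> U" for c x
    using U_mult[OF that, of "scale c 1"] by (simp add: scale_mult_left)
  have U_sub: "subspace U"
    using U0 U_add U_scale by (auto simp: subspace_def)
  interpret vector_space_pair scale scale by unfold_locales
  obtain \<pi> where \<pi>: "range \<pi> \<subseteq> U" "endo \<pi>" "\<And>u. u \<in> U \<Longrightarrow> \<pi> u = u"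
    using linear_exists_left_inverse_on[of "\<lambda>x. x", OF endo_ident U_sub] by auto
  have endo_\<pi>: "endo (\<lambda>x. \<pi> (g x))" if "endo g" for g
    using \<pi>(2) that by (simp add: endo_iff)
  note intros = multilinear_intros endo_antipode endo_\<pi>
  \<comment> \<open>The average of the linear projection \<pi> by \<open>t\<close>. On
    \<open>U\<close> it is multiplication by \<beta>, and it satisfies an invariance in place of
    linearity over the algebra; \<open>p\<close> repairs both.\<close>
  define f where "f m = sweedler2 (\<Delta> t) (\<lambda>a b. a * \<beta> * \<pi> (S b * m))" for m
  have endo_f: "endo (\<lambda>x. f (g x))" if "endo g" for g
    unfolding f_def by (intro intros that)
  note intros = intros endo_f
  have f_mem: "f m \<in> U" for m
    unfolding f_def sweedler2_def tensor_lift_def lin_ext_def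
    using \<pi>(1) U_mult by (intro subspace_sum[OF U_sub] U_scale) blast
  have f_id: "f u = \<beta> * u" if "u \<in> U" for u
  proof -
    have "f u = sweedler2 (\<Delta> t) (\<lambda>a b. (a * \<beta> * S b) * u)"
      using that U_mult \<pi>(3) by (simp add: f_def mult.assoc)
    also have "\<dots> = scale (\<epsilon> t) (\<beta> * u)"
      by (rule sweedler2_antipode_right) (intro intros)
    finally show ?thesis using assms(2) by simp
  qed
  \<comment> \<open>Since \<Delta> is multiplicative and \<open>S\<close> reverses products, the
    left side is the formula for \<open>f\<close> with \<open>h * t\<close> in place of
    \<open>t\<close>.\<close>
  have f_invariant: "sweedler2 (\<Delta> h) (\<lambda>a b. a * f (S b * m)) = scale (\<epsilon> h) (f m)" for h m
  proof -
    have "sweedler2 (\<Delta> h) (\<lambda>a b. a * f (S b * m)) =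
        sweedler2 (\<Delta> h) (\<lambda>a b. sweedler2 (\<Delta> t) (\<lambda>c d. (a * c) * \<beta> * \<pi> (S (b * d) * m)))"
      unfolding f_def
      by (subst sweedler2_linear_image, intro intros) (simp add: antipode_mult mult.assoc)
    also have "\<dots> = sweedler2 (\<Delta> (h * t)) (\<lambda>a b. a * \<beta> * \<pi> (S b * m))"
      by (rule sweedler2_comult_mult[symmetric]) (intro intros)
    also have "\<dots> = scale (\<epsilon> h) (f m)"
      unfolding integral f_def by (rule sweedler2_comult_scale) (intro intros)
    finally show ?thesis .
  qed
  \<comment> \<open>The legs of \<Phi> are placed so that \<open>antipode_assoc\<close> turns the
    \<beta> that \<open>f\<close> leaves on \<open>U\<close> into 1.\<close>
  define p where "p m = sweedler3 \<Phi> (\<lambda>x y z. x * f (S y * \<alpha> * z * m))" for m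
  have endo_p: "endo p"
    unfolding p_def by (intro intros)
  have p_mem: "p m \<in> U" for m
    unfolding p_def sweedler3_def tensor_lift_def lin_ext_def
    using f_mem U_mult by (intro subspace_sum[OF U_sub] U_scale) blast
  have p_id: "p u = u" if "u \<in> U" for u
  proof -
    have "p u = sweedler3 \<Phi> (\<lambda>x y z. (x * \<beta> * S y * \<alpha> * z) * u)"
      using that U_mult by (simp add: p_def f_id mult.assoc)
    also have "\<dots> = 1 * u"
      by (rule sweedler3_antipode) (intro intros)
    finally show ?thesis by simp
  qed
  have p_mult: "p (h * m) = h * p m" for h m
  proof -
    let ?G = "\<lambda>q r s. q * f (S r * \<alpha> * s * m)"
    have "h * p m = sweedler3 \<Phi> (\<lambda>x y z. h * ?G x y z)"
      unfolding p_def by (rule sweedler3_linear_image) (intro intros)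
    also have "\<dots> = sweedler3 \<Phi> (\<lambda>x y z. sweedler2 (\<Delta> h) (\<lambda>a b. scale (\<epsilon> b) (a * ?G x y z)))"
      by (subst sweedler2_counit_right, intro intros) simp
    \<comment> \<open>The antipode axiom, read backwards, absorbs \<epsilon> of the second leg of
      \<Delta>(h) into \<alpha>. This creates the iterated coproduct that
      \<open>sweedler_coassoc\<close> re-brackets next.\<close>
    also have "\<dots> = sweedler3 \<Phi> (\<lambda>x y z. sweedler2 (\<Delta> h) (\<lambda>a b. sweedler2 (\<Delta> b) (\<lambda>c d.
        a * (x * f (S y * (S c * \<alpha> * d) * z * m)))))"
      by (subst sweedler2_antipode_left[of "\<lambda>k. _ * (_ * f (S _ * k * _ * m))"], intro intros) simp
    also have "\<dots> = sweedler3 \<Phi> (\<lambda>x y z. sweedler2 (\<Delta> h) (\<lambda>a b. sweedler2 (\<Delta> b) (\<lambda>c d.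
        ?G (a * x) (c * y) (d * z))))"
      by (simp add: antipode_mult mult.assoc)
    also have "\<dots> = sweedler3 \<Phi> (\<lambda>x y z. sweedler2 (\<Delta> h) (\<lambda>a b. sweedler2 (\<Delta> a) (\<lambda>c d.
        ?G (x * c) (y * d) (z * b))))"
      by (rule sweedler_coassoc) (intro intros)
    \<comment> \<open>Now the first two legs surround \<open>f\<close>, whose invariance collapses
      them to \<epsilon>, and the third leg acts on \<open>m\<close>.\<close>
    also have "\<dots> = sweedler3 \<Phi> (\<lambda>x y z. sweedler2 (\<Delta> h) (\<lambda>a b. scale (\<epsilon> a) (x * f (S y * \<alpha> * z * (b * m)))))"
    proof -
      have "sweedler2 (\<Delta> a) (\<lambda>c d. ?G (x * c) (y * d) (z * b)) = scale (\<epsilon> a) (x * f (S y * \<alpha> * z * (b * m)))"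
        for a b x y z
      proof -
        have "sweedler2 (\<Delta> a) (\<lambda>c d. x * (c * f (S d * (S y * \<alpha> * z * (b * m))))) =
          x * sweedler2 (\<Delta> a) (\<lambda>c d. c * f (S d * (S y * \<alpha> * z * (b * m))))"
          by (rule sweedler2_linear_image[symmetric]) (intro intros)
        then show ?thesis
          by (simp add: f_invariant antipode_mult mult.assoc scale_mult_right)
      qed
      then show ?thesis by simp
    qed
    also have "\<dots> = p (h * m)"
      unfolding p_def by (subst sweedler2_counit_left, intro intros) (rule refl)
    finally show ?thesis by simp
  qed
  have p_add: "p (x + y) = p x + p y" for x y
    using endo_p by (simp add: endo_iff)
  have p_diff: "p (x - p x) = 0" for x
    using p_add[of "x - p x" "p x"] p_id[OF p_mem[of x]] by simp
  let ?W = "{x. p x = 0}"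
  have "submodule (*) ?W"
    using p_add[of 0 0] by (auto simp: submodule_def p_add p_mult)
  moreover have "U \<inter> ?W = {0}"
    using p_id U0 by force
  moreover have "{u + w | u w. u \<in> U \<and> w \<in> ?W} = UNIV"
  proof -
    have "x = p x + (x - p x) \<and> p x \<in> U \<and> x - p x \<in> ?W" for x
      using p_mem p_diff by simp
    then show ?thesis by blast
  qed
  ultimately show "\<exists>W. submodule (*) W \<and> U \<inter> W = {0} \<and> {u + w | u w. u \<in> U \<and> w \<in> W} = UNIV"
    by blast
qed

end


section \<open>Partial traces on projective modules\<close>

text \<open>
  A finite-dimensional projective module with a basis \<open>B\<close> over the field, the coordinates \<open>coord b\<close>,
  and a finite dual basis given by the vectors \<open>v w\<close> and the module maps \<open>\<phi> w\<close> to the algebra.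
\<close>

locale quasi_hopf_projective = quasi_hopf_algebra scale \<Delta> \<epsilon> \<Phi> \<Phi>i S \<alpha> \<beta> + left_module act
  for scale :: "'k::field \<Rightarrow> 'h::ring_1 \<Rightarrow> 'h"
    and \<Delta> :: "'h \<Rightarrow> ('h, 'k) tensor"
    and \<epsilon> :: "'h \<Rightarrow> 'k"
    and \<Phi> \<Phi>i :: "('h, 'k) tensor"
    and S :: "'h \<Rightarrow> 'h"
    and \<alpha> \<beta> :: 'h
    and act :: "'h \<Rightarrow> 'p::ab_group_add \<Rightarrow> 'p" +
  fixes B :: "'p set" and coord :: "'p \<Rightarrow> 'p \<Rightarrow> 'k"
    and W :: "'i set" and \<phi> :: "'i \<Rightarrow> 'p \<Rightarrow> 'h" and v :: "'i \<Rightarrow> 'p"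
  assumes coord_add: "coord b (x + y) = coord b x + coord b y"
    and coord_scale: "coord b (act (scale c 1) x) = c * coord b x"
    and coord_basis: "b \<in> B \<Longrightarrow> coord b b = 1"
    and sum_coord: "(\<Sum>b\<in>B. act (scale (coord b x) 1) b) = x"
    and phi_add: "\<phi> w (x + y) = \<phi> w x + \<phi> w y"
    and phi_act: "\<phi> w (act h x) = h * \<phi> w x"
    and sum_phi: "(\<Sum>w\<in>W. act (\<phi> w x) (v w)) = x"
begin

lemma act_scale: "act (scale c h) x = act (scale c 1) (act h x)"
  using act_mult[of "scale c 1" h x] by (simp add: scale_mult_left)

lemma act_scale': "act h (act (scale c 1) x) = act (scale c 1) (act h x)"
proof -
  have "act (h * scale c 1) x = act (scale c 1 * h) x"
    by (simp only: scale_mult_left scale_mult_right mult_1_left mult_1_right)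
  then show ?thesis by (simp only: act_mult)
qed

lemma coord_zero: "coord b 0 = 0"
  using coord_scale[of b 0 0] by simp

lemma coord_sum: "coord b (sum f I) = (\<Sum>i\<in>I. coord b (f i))"
  by (induction I rule: infinite_finite_induct) (auto simp: coord_add coord_zero)

lemma phi_zero: "\<phi> w 0 = 0"
  using phi_add[of w 0 0] by simp

lemma phi_sum: "\<phi> w (sum f I) = (\<Sum>i\<in>I. \<phi> w (f i))"
  by (induction I rule: infinite_finite_induct) (auto simp: phi_add phi_zero)

lemma endo_coord:
  assumes "endo g"
  shows "endo (\<lambda>h. scale (coord b (act (g h) x)) c)"
  using assms unfolding endo_iff
  by (simp add: act_add_left coord_add act_scale[of _ "g _"] coord_scale scale_left_distrib)

lemma endo_phi:
  assumes "endo g"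
  shows "endo (\<lambda>h. \<phi> w (act (g h) x))"
  using assms unfolding endo_iff
  by (simp add: act_add_left phi_add phi_act scale_mult_left distrib_right)

lemmas module_intros = multilinear_intros endo_antipode endo_coord endo_phi

lemma act_coord: "act h x = (\<Sum>b\<in>B. act (scale (coord b x) 1) (act h b))"
  by (subst sum_coord[of x, symmetric]) (simp only: act_sum act_scale')

lemma coord_act: "coord b (act h x) = (\<Sum>b'\<in>B. coord b' x * coord b (act h b'))"
  by (subst act_coord) (simp only: coord_sum coord_scale)

lemma phi_coord: "\<phi> w (act h x) = (\<Sum>b\<in>B. scale (coord b x) (\<phi> w (act h b)))"
  by (subst act_coord) (simp add: phi_sum phi_act scale_mult_left)

definition trace_act :: "'h \<Rightarrow> 'k" where
  "trace_act h = (\<Sum>b\<in>B. coord b (act h b))"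

lemma trace_act_one: "trace_act 1 = of_nat (card B)"
  by (simp add: trace_act_def act_one coord_basis)

lemma trace_act_commute: "trace_act (x * y) = trace_act (y * x)"
proof -
  have "trace_act (x * y) = (\<Sum>b\<in>B. \<Sum>b'\<in>B. coord b' (act y b) * coord b (act x b'))"
    by (simp add: trace_act_def act_mult coord_act[of _ x "act y _"])
  also have "\<dots> = (\<Sum>b'\<in>B. \<Sum>b\<in>B. coord b (act x b') * coord b' (act y b))"
    by (subst sum.swap) (simp only: mult.commute)
  also have "\<dots> = trace_act (y * x)"
    by (simp add: trace_act_def act_mult coord_act[of _ y "act x _"])
  finally show ?thesis .
qed

text \<open>
  The map $\sigma(x) = \sum_w \Delta(\varphi_w(x)) (1 \otimes v_w)$ is an $H$-linear section of
  $\varepsilon \otimes id : H \otimes P \to P$, and \<open>partial_trace a c \<eta>\<close> is the trace over \<open>P\<close> of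
  $x \mapsto (a \otimes c) \sigma(\eta x)$, an element of \<open>H\<close>.
\<close>

definition partial_trace :: "'h \<Rightarrow> 'h \<Rightarrow> 'h \<Rightarrow> 'h" where
  "partial_trace a c \<eta> = (\<Sum>b\<in>B. \<Sum>w\<in>W.
     sweedler2 (\<Delta> (\<phi> w (act \<eta> b))) (\<lambda>d e. scale (coord b (act (c * e) (v w))) (a * d)))"

lemma trilin_partial_trace: "trilin partial_trace"
  unfolding partial_trace_def by (intro module_intros)

lemma mult_partial_trace: "h * partial_trace a c \<eta> = partial_trace (h * a) c \<eta>"
proof -
  have "h * sweedler2 T (\<lambda>d e. scale (k d e) (a * d)) = sweedler2 T (\<lambda>d e. scale (k d e) (h * a * d))"
    for T k
    by (subst sweedler2_linear_image[of "\<lambda>x. h * x"], intro module_intros) (simp add: scale_mult_right mult.assoc)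
  then show ?thesis by (simp add: partial_trace_def sum_distrib_left)
qed

text \<open>This is the linearity of \<sigma> over the algebra: each \<open>\<phi> w\<close> is a
  module map and \<Delta> is multiplicative, so \<sigma>(h x) = \<Delta>(h) \<sigma>(x).\<close>

lemma partial_trace_comult:
  "sweedler2 (\<Delta> h) (\<lambda>x y. partial_trace (a * x) (c * y) \<eta>) = partial_trace a c (h * \<eta>)"
proof -
  have "partial_trace a c (h * \<eta>) = (\<Sum>b\<in>B. \<Sum>w\<in>W. sweedler2 (\<Delta> h) (\<lambda>x y.
     sweedler2 (\<Delta> (\<phi> w (act \<eta> b))) (\<lambda>d e. scale (coord b (act (c * (y * e)) (v w))) (a * (x * d)))))"
    unfolding partial_trace_def act_mult[of h] phi_act[of _ h]
    by (subst sweedler2_comult_mult, intro module_intros) (rule refl)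
  then show ?thesis
    unfolding partial_trace_def sweedler2_sum by (simp only: mult.assoc)
qed

text \<open>Cyclicity of the trace over the module: \<open>r\<close> acts on the module leg after
  \<sigma> and is moved in front of \<sigma> by expanding its action in the basis
  \<open>B\<close>.\<close>

lemma partial_trace_cyclic: "partial_trace a (r * c) \<eta> = partial_trace a c (\<eta> * r)"
proof -
  let ?K = "\<lambda>b w d e. scale (coord b (act (c * e) (v w))) (a * d)"
  let ?r = "\<lambda>b b'. coord b (act r b')"
  have K: "bilin (?K b w)" for b w by (intro module_intros)
  have "sweedler2 T (\<lambda>d e. scale (coord b (act (r * c * e) (v w))) (a * d)) =
      (\<Sum>b'\<in>B. scale (?r b b') (sweedler2 T (?K b' w)))" for T b w
  proof -
    have "scale (coord b (act (r * c * e) (v w))) (a * d) = (\<Sum>b'\<in>B. scale (?r b b') (?K b' w d e))" for d e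
      unfolding mult.assoc[of r] act_mult[of r] coord_act[of b r "act _ _"]
      by (simp add: scale_sum_left mult.commute)
    moreover have "scale q (sweedler2 T g) = sweedler2 T (\<lambda>d e. scale q (g d e))" for q g
      by (rule sweedler2_linear_image) (intro module_intros)
    ultimately show ?thesis by (simp add: sweedler2_sum)
  qed
  then have "partial_trace a (r * c) \<eta> =
      (\<Sum>b\<in>B. \<Sum>w\<in>W. \<Sum>b'\<in>B. scale (?r b b') (sweedler2 (\<Delta> (\<phi> w (act \<eta> b))) (?K b' w)))"
    by (simp add: partial_trace_def)
  also have "\<dots> = (\<Sum>b'\<in>B. \<Sum>w\<in>W. \<Sum>b\<in>B. scale (?r b b') (sweedler2 (\<Delta> (\<phi> w (act \<eta> b))) (?K b' w)))"
    by (subst (1 2) sum.swap) (subst sum.swap, rule refl)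
  \<comment> \<open>For fixed \<open>b'\<close> the sum over \<open>b\<close> reassembles
    \<open>act r b'\<close> from its coordinates, by linearity of \<open>\<phi> w\<close> and
    \<Delta>.\<close>
  also have "\<dots> = (\<Sum>b'\<in>B. \<Sum>w\<in>W. sweedler2 (\<Delta> (\<phi> w (act (\<eta> * r) b'))) (?K b' w))"
  proof (intro sum.cong refl)
    fix b' w
    interpret L: Vector_Spaces.linear scale scale "\<lambda>x. sweedler2 (\<Delta> x) (?K b' w)"
      by (intro endo_intros K)
    show "(\<Sum>b\<in>B. scale (?r b b') (sweedler2 (\<Delta> (\<phi> w (act \<eta> b))) (?K b' w))) =
        sweedler2 (\<Delta> (\<phi> w (act (\<eta> * r) b'))) (?K b' w)"
      unfolding act_mult[of \<eta> r] phi_coord[of w \<eta> "act r b'"] L.sum L.scale by (rule refl)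
  qed
  finally show ?thesis by (simp add: partial_trace_def)
qed

text \<open>Applying \<epsilon> to the algebra leg of \<sigma> gives the identity of the module, so
  the ordinary trace of \<open>c * \<eta>\<close> remains. Both sides are multiples of 1 because the
  Sweedler sums take values in the algebra.\<close>

lemma counit_partial_trace:
  "scale (\<epsilon> (partial_trace a c \<eta>)) 1 = scale (\<epsilon> a * trace_act (c * \<eta>)) 1"
proof -
  let ?L = "\<lambda>x. scale (\<epsilon> x) 1 :: 'h"
  interpret L: Vector_Spaces.linear scale scale ?L by (intro endo_intros)
  have "?L (sweedler2 (\<Delta> h) (\<lambda>d e. scale (coord b (act (c * e) y)) (a * d))) =
      scale (coord b (act (c * h) y)) (?L a)" for h b y
  proof -
    have "?L (sweedler2 (\<Delta> h) (\<lambda>d e. scale (coord b (act (c * e) y)) (a * d))) =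
        sweedler2 (\<Delta> h) (\<lambda>d e. scale (\<epsilon> d) (scale (coord b (act (c * e) y)) (?L a)))"
      by (subst sweedler2_linear_image[of ?L], intro endo_intros)
        (simp add: counit_scale counit_mult mult_ac)
    also have "\<dots> = scale (coord b (act (c * h) y)) (?L a)"
      by (rule sweedler2_counit_left) (intro module_intros)
    finally show ?thesis .
  qed
  then have "?L (partial_trace a c \<eta>) =
      (\<Sum>b\<in>B. \<Sum>w\<in>W. scale (coord b (act (c * \<phi> w (act \<eta> b)) (v w))) (?L a))"
    unfolding partial_trace_def L.sum by simp
  also have "\<dots> = (\<Sum>b\<in>B. scale (coord b (act c (\<Sum>w\<in>W. act (\<phi> w (act \<eta> b)) (v w)))) (?L a))"
    by (simp only: scale_sum_left[symmetric] act_mult act_sum coord_sum)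
  also have "\<dots> = scale (trace_act (c * \<eta>)) (?L a)"
    by (simp only: sum_phi trace_act_def act_mult scale_sum_left)
  finally show ?thesis by (simp add: mult.commute)
qed

section \<open>A left integral whose counit is the dimension\<close>

text \<open>Invertibility of u = S(\<beta>)\<alpha> is assumed on both sides; in a finite
  dimensional algebra the second identity will follow from the first.\<close>

lemma exists_integral_counit_card:
  assumes inv: "S \<beta> * \<alpha> * (\<beta> * S \<alpha>) = 1" "\<beta> * S \<alpha> * (S \<beta> * \<alpha>) = 1"
    and S2: "\<And>h. S (S h) = S \<beta> * \<alpha> * h * (\<beta> * S \<alpha>)"
  shows "\<exists>t. (\<forall>h. h * t = scale (\<epsilon> h) t) \<and> \<epsilon> t = of_nat (card B)"
proof -
  define \<kappa> where "\<kappa> = S \<alpha> * (S \<beta> * \<alpha>)"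
  note tri = trilin_endo1[OF trilin_partial_trace] trilin_endo2[OF trilin_partial_trace]
    trilin_endo3[OF trilin_partial_trace]
  note intros = module_intros tri
  have \<kappa>: "sweedler2 (\<Delta> h) (\<lambda>a b. S b * \<kappa> * a) = scale (\<epsilon> h) \<kappa>" for h
  proof -
    \<comment> \<open>With u = S(\<beta>)\<alpha>, the right side is S(b)S(\<alpha>)S(S(a))u, and
      S(S(a))u = u a because the square of \<open>S\<close> is conjugation by u.\<close>
    have "S b * \<kappa> * a = S (S a * \<alpha> * b) * (S \<beta> * \<alpha>)" for a b
    proof -
      have "S (S a * \<alpha> * b) * (S \<beta> * \<alpha>) = S b * S \<alpha> * (S \<beta> * \<alpha> * a) * (\<beta> * S \<alpha> * (S \<beta> * \<alpha>))"
        by (simp only: antipode_mult S2 mult.assoc)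
      then have "S (S a * \<alpha> * b) * (S \<beta> * \<alpha>) = S b * S \<alpha> * (S \<beta> * \<alpha> * a)"
        by (simp only: inv(2) mult_1_right)
      then show ?thesis by (simp only: \<kappa>_def mult.assoc)
    qed
    then have "sweedler2 (\<Delta> h) (\<lambda>a b. S b * \<kappa> * a) = scale (\<epsilon> h) (S \<alpha> * (S \<beta> * \<alpha>))"
      by (simp only:) (rule sweedler2_antipode_left, intro intros)
    then show ?thesis by (simp add: \<kappa>_def)
  qed
  \<comment> \<open>The second and third legs surround \<kappa>, which absorbs the second leg of
    \<Delta>(h); after re-bracketing, the \<beta> in the third argument absorbs the coproduct
    again.\<close>
  let ?G = "\<lambda>x y z. partial_trace x (S z * \<kappa> * y) \<beta>"
  define t where "t = sweedler3 \<Phi> ?G"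
  have "h * t = scale (\<epsilon> h) t" for h
  proof -
    have "h * t = sweedler3 \<Phi> (\<lambda>x y z. h * ?G x y z)"
      unfolding t_def by (rule sweedler3_linear_image) (intro intros)
    also have "\<dots> = sweedler3 \<Phi> (\<lambda>x y z. sweedler2 (\<Delta> h) (\<lambda>a b. scale (\<epsilon> b) (?G (a * x) y z)))"
      by (subst sweedler2_counit_right, intro intros) (simp only: mult_partial_trace)
    also have "\<dots> = sweedler3 \<Phi> (\<lambda>x y z. sweedler2 (\<Delta> h) (\<lambda>a b. sweedler2 (\<Delta> b) (\<lambda>c d.
        ?G (a * x) (c * y) (d * z))))"
    proof -
      have "sweedler2 (\<Delta> b) (\<lambda>c d. ?G x (c * y) (d * z)) = scale (\<epsilon> b) (?G x y z)" for b x y z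
      proof -
        have "sweedler2 (\<Delta> b) (\<lambda>c d. partial_trace x (S z * (S d * \<kappa> * c) * y) \<beta>) =
            partial_trace x (S z * sweedler2 (\<Delta> b) (\<lambda>c d. S d * \<kappa> * c) * y) \<beta>"
          by (rule sweedler2_linear_image[symmetric]) (intro intros)
        also have "\<dots> = scale (\<epsilon> b) (?G x y z)"
          using tri(2)[OF endo_ident] unfolding endo_iff \<kappa>
          by (simp add: scale_mult_left scale_mult_right)
        finally show ?thesis by (simp add: antipode_mult mult.assoc)
      qed
      then show ?thesis by simp
    qed
    also have "\<dots> = sweedler3 \<Phi> (\<lambda>x y z. sweedler2 (\<Delta> h) (\<lambda>a b. sweedler2 (\<Delta> a) (\<lambda>c d.
        ?G (x * c) (y * d) (z * b))))"
      by (rule sweedler_coassoc) (intro intros)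
    also have "\<dots> = sweedler3 \<Phi> (\<lambda>x y z. sweedler2 (\<Delta> h) (\<lambda>a b.
        partial_trace x (S z * \<kappa> * y) (a * \<beta> * S b)))"
    proof -
      \<comment> \<open>Linearity of \<sigma> turns the two legs of \<Delta>(a) into a factor
        \<open>a\<close> before \<beta>, and cyclicity carries S(b) behind \<beta>. This prepares
        the right antipode axiom.\<close>
      have "sweedler2 (\<Delta> a) (\<lambda>c d. ?G (x * c) (y * d) (z * b)) =
          partial_trace x (S z * \<kappa> * y) (a * \<beta> * S b)" for a b x y z
        using partial_trace_comult[of a x "S b * (S z * \<kappa> * y)" \<beta>]
        by (simp add: antipode_mult mult.assoc partial_trace_cyclic)
      then show ?thesis by simp
    qed
    also have "\<dots> = sweedler3 \<Phi> (\<lambda>x y z. scale (\<epsilon> h) (?G x y z))"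
      by (subst sweedler2_antipode_right, intro intros) (rule refl)
    also have "\<dots> = scale (\<epsilon> h) t"
      unfolding t_def by (rule sweedler3_linear_image[symmetric]) (intro intros)
    finally show ?thesis .
  qed
  moreover have "\<epsilon> t = of_nat (card B)"
  proof -
    let ?L = "\<lambda>x. scale (\<epsilon> x) 1 :: 'h"
    have endo_trace: "endo (\<lambda>h. scale (trace_act (g h)) c)" if "endo g" for g c
      unfolding trace_act_def scale_sum_left by (intro intros that)
    have "?L t = sweedler3 \<Phi> (\<lambda>x y z. ?L (?G x y z))"
      unfolding t_def by (rule sweedler3_linear_image) (intro intros)
    also have "\<dots> = sweedler3 \<Phi> (\<lambda>x y z. scale (\<epsilon> x) (scale (trace_act (S z * \<kappa> * y * \<beta>)) 1))"
      by (simp only: counit_partial_trace scale_scale)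
    \<comment> \<open>With \<epsilon> on its first leg \<Phi> becomes 1 \<otimes> 1, so both
      remaining legs are replaced by 1 and the trace of \<kappa>\<beta> is left.\<close>
    also have "\<dots> = scale (trace_act (S 1 * \<kappa> * 1 * \<beta>)) 1"
      by (rule sweedler3_assoc_counit_left) (intro intros endo_trace)
    finally have "\<epsilon> (?L t) = \<epsilon> (scale (trace_act (S 1 * \<kappa> * 1 * \<beta>)) 1)"
      by (rule arg_cong)
    then have "\<epsilon> t = trace_act (S \<alpha> * (S \<beta> * \<alpha> * \<beta>))"
      by (simp add: counit_scale counit_one antipode_one \<kappa>_def mult.assoc)
    \<comment> \<open>Moving S(\<alpha>) to the end yields u times its inverse, so the trace is that
      of the identity.\<close>
    also have "\<dots> = trace_act (S \<beta> * \<alpha> * (\<beta> * S \<alpha>))"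
      by (subst trace_act_commute) (simp only: mult.assoc)
    finally show ?thesis by (simp only: inv(1) trace_act_one)
  qed
  ultimately show ?thesis by blast
qed

end

section \<open>Application to a finite dimensional projective module\<close>

text \<open>Left multiplication by \<open>y\<close> is undone by left multiplication by
  \<open>x\<close>, so it is injective and, in finite dimension, surjective. The resulting right
  inverse of \<open>y\<close> equals \<open>x\<close>.\<close>

lemma (in assoc_algebra) right_inverse_if_left_inverse:
  fixes x y :: 'h
  assumes "finite_dim scale" "x * y = 1"
  shows "y * x = 1"
proof -
  obtain F where F: "finite F" "span F = UNIV"
    using assms(1) by (auto simp: finite_dim_def)
  obtain C where C: "C \<subseteq> F" "independent C" "F \<subseteq> span C"
    using maximal_independent_subset by blast
  have "span C = UNIV"
    using span_mono[OF C(3)] F(2) by (simp add: span_span top_unique)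
  with C F interpret finite_dimensional_vector_space scale C
    by unfold_locales (auto intro: finite_subset)
  have "inj (\<lambda>z. y * z)"
    by (rule inj_on_inverseI[of _ "\<lambda>z. x * z"]) (simp add: assms(2) flip: mult.assoc)
  then have "surj (\<lambda>z. y * z)"
    by (rule linear_inj_imp_surj[OF endo_mult_left[OF endo_ident]])
  then obtain z where z: "y * z = 1" by (metis surjD)
  then have "x = x * (y * z)" by simp
  also have "\<dots> = z" using assms(2) by (simp flip: mult.assoc)
  finally show ?thesis using z by simp
qed

theorem theorem4p5:
  fixes scale :: "'k::field \<Rightarrow> 'h::ring_1 \<Rightarrow> 'h"
    and \<Delta> :: "'h \<Rightarrow> ('h, 'k) tensor"
    and \<epsilon> :: "'h \<Rightarrow> 'k"
    and \<Phi> \<Phi>i :: "('h, 'k) tensor"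
    and S :: "'h \<Rightarrow> 'h"
    and \<alpha> \<beta> :: 'h
    and act :: "'h \<Rightarrow> 'p::ab_group_add \<Rightarrow> 'p"
  assumes "quasi_hopf_algebra scale \<Delta> \<epsilon> \<Phi> \<Phi>i S \<alpha> \<beta>"
    and "finite_dim scale"
    and "involutory S \<alpha> \<beta>"
    and "\<not> semisimple_ring TYPE('h)"
    and "left_module act"
    and "projective act"
    and "finite_dim (\<lambda>c. act (scale c 1))"
  shows "CHAR('k) dvd vector_space.dim (\<lambda>c. act (scale c 1)) (UNIV :: 'p set)"
proof (rule ccontr)
  assume not_dvd: "\<not> ?thesis"
  interpret quasi_hopf_algebra scale \<Delta> \<epsilon> \<Phi> \<Phi>i S \<alpha> \<beta> by fact
  interpret P: left_module act by fact
  let ?sc = "\<lambda>c. act (scale c 1)"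
  interpret V: vector_space ?sc
    by unfold_locales
      (simp_all add: scale_left_distrib P.act_add_left P.act_add_right P.act_one scale_mult_left
        flip: P.act_mult)
  have S2: "S (S h) = S \<beta> * \<alpha> * h * (\<beta> * S \<alpha>)" for h
    using assms(3) by (simp add: involutory_def mult.assoc)
  \<comment> \<open>The involutory identity at \<open>h = 1\<close>.\<close>
  have inv: "S \<beta> * \<alpha> * (\<beta> * S \<alpha>) = 1"
    using S2[of 1] by (simp add: antipode_one)
  obtain F where F: "finite F" "V.span F = UNIV"
    using assms(7) by (auto simp: finite_dim_def)
  obtain B where B: "B \<subseteq> F" "V.independent B" "F \<subseteq> V.span B"
    using V.maximal_independent_subset by blast
  have finite_B: "finite B" using B(1) F(1) by (rule finite_subset)
  have span_B: "V.span B = UNIV"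
    using V.span_mono[OF B(3)] F(2) by (simp add: V.span_span top_unique)
  have dim: "V.dim UNIV = card B"
    using V.dim_eq_card[OF _ B(2), of UNIV] span_B by (simp add: V.span_UNIV)
  obtain i :: "'p \<Rightarrow> ('p \<Rightarrow>\<^sub>0 'h)" and q where i: "module_map act free_act i"
    and q: "module_map free_act act q" and qi: "\<And>x. q (i x) = x"
    using assms(6) by (auto simp: projective_def)
  \<comment> \<open>The finitely many free generators that occur in the images of the basis
    \<open>B\<close>. By linearity they suffice for every \<open>i x\<close>, which makes the dual
    basis finite.\<close>
  define W where "W = (\<Union>b\<in>B. Poly_Mapping.keys (i b))"
  define \<phi> where "\<phi> w x = Poly_Mapping.lookup (i x) w" for w x
  have phi_add: "\<phi> w (x + y) = \<phi> w x + \<phi> w y" and phi_act: "\<phi> w (act h x) = h * \<phi> w x" for w x y h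
    using i by (simp_all add: module_map_def \<phi>_def lookup_add)
  have finite_W: "finite W" using finite_B by (simp add: W_def)
  have keys: "Poly_Mapping.keys (i x) \<subseteq> W" for x
  proof -
    have "x \<in> V.span B" by (simp add: span_B)
    then have "\<phi> w x = 0" if "w \<notin> W" for w
    proof (induction rule: V.span_induct_alt)
      case base
      show ?case using phi_act[of w 0 0] by simp
    next
      case (step c x y)
      then have "\<phi> w x = 0" using that by (auto simp: \<phi>_def W_def in_keys_iff)
      with step show ?case by (simp add: phi_add phi_act)
    qed
    then show ?thesis by (auto simp: \<phi>_def in_keys_iff)
  qed
  \<comment> \<open>A module map out of a free module is determined by its values on the generators,
    so \<open>q (i x) = x\<close> becomes the dual basis identity.\<close>
  have q_eq: "q t = free_lift act (\<lambda>w. q (Poly_Mapping.single w 1)) t" for t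
    by (rule free_map_eqI[OF q P.module_map_free_lift]) (simp add: P.act_one)
  have sum_phi: "(\<Sum>w\<in>W. act (\<phi> w x) (q (Poly_Mapping.single w 1))) = x" for x
    using qi[of x] P.free_lift_superset[OF finite_W keys] by (simp add: q_eq[of "i x"] \<phi>_def)
  interpret quasi_hopf_projective scale \<Delta> \<epsilon> \<Phi> \<Phi>i S \<alpha> \<beta> act B "\<lambda>b x. V.representation B x b" W \<phi>
    "\<lambda>w. q (Poly_Mapping.single w 1)"
    using finite_B phi_add phi_act sum_phi
    by unfold_locales
      (simp_all add: V.representation_add V.representation_scale V.representation_basis B(2) span_B
        V.sum_representation_eq)
  obtain t where t: "\<And>h. h * t = scale (\<epsilon> h) t" "\<epsilon> t = of_nat (card B)"
    using exists_integral_counit_card[OF inv right_inverse_if_left_inverse[OF assms(2) inv] S2] by blast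
  \<comment> \<open>\<open>CHAR('k)\<close> divides \<open>card B\<close> exactly when the image of
    \<open>card B\<close> in the field is 0; in characteristic 0 both say that \<open>card B\<close>
    is 0. So \<open>t\<close> can be divided by its counit.\<close>
  have "(of_nat (card B) :: 'k) \<noteq> 0"
    using not_dvd by (simp add: dim of_nat_eq_0_iff_char_dvd)
  then have "semisimple_ring TYPE('h)"
    using t by (intro semisimple_if_normalized_integral[of "scale (inverse (of_nat (card B))) t"])
      (simp_all add: scale_mult_right counit_scale mult.commute)
  with assms(4) show False by contradiction
qed

end
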